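(* Let $\mathbb{T}^n=\mathbb{R}^n/\mathbb{Z}^n$, let $P\in\mathbb{R}^n$, let $s_L>0$ and $d>0$ be constants, and let $V:\mathbb{T}^n\to\mathbb{R}^n$ be a smooth vector field that is divergence free and has mean zero ($\int_{\mathbb{T}^n}V\,dx=0$). Given any $u^{(1)}\in H^1_{per}$, let $\{u^{(k)}\}_{k\in\mathbb{N}}$ be the sequence in $H^1_{per}$ defined by the iteration scheme: $u^{(k+1)}\in H^1_{per}$ is the unique weak solution of $$-d\,s_L\,\Delta u^{(k+1)}+V(x)\cdot Du^{(k+1)}=H^{(k)}-s_L\,|P+Du^{(k)}|-V(x)\cdot P,\qquad x\in\mathbb{T}^n,$$ where $$H^{(k)}=s_L\int_{\mathbb{T}^n}|P+Du^{(k)}|\,dx.$$ If $d>\sqrt{n}/\pi$, then the sequence $\{u^{(k)}\}_{k\in\mathbb{N}}$ converges in $H^1_{per}$.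
   Context: $L^2_{per}$ and $H^1_{per}$ denote the spaces of all mean zero, ($\mathbb{Z}^n$-)periodic functions in $L^2(\mathbb{T}^n)$ and $H^1(\mathbb{T}^n)$ respectively. $D$ denotes the gradient, $\Delta$ the Laplacian, and $|\cdot|$ the Euclidean norm. The torus $\mathbb{T}^n$ has total volume $1$. The sequence is well defined: if $u^{(k)}\in H^1_{per}$, then the right-hand side of the equation belongs to $L^2_{per}$, and the linear equation has a unique weak solution $u^{(k+1)}\in H^1_{per}$. *)

theory Defs
  imports "HOL-Analysis.Analysis"
begin

text \<open>Functions on the torus are represented by everywhere-defined periodic functions on
  \<open>\<real>\<^sup>n\<close>; integration over the torus is Lebesgue integration over the unit cube, which has
  volume 1 and whose boundary is a null set.\<close>

definition periodic :: "(real^'n \<Rightarrow> 'b) \<Rightarrow> bool" where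
  "periodic f \<longleftrightarrow> (\<forall>x m. (\<forall>i. m $ i \<in> \<int>) \<longrightarrow> f (x + m) = f x)"

definition torus :: "(real^'n) measure" where
  "torus = lebesgue_on (cbox 0 1)"

definition partial_deriv :: "'n \<Rightarrow> (real^'n \<Rightarrow> 'b::real_normed_vector) \<Rightarrow> real^'n \<Rightarrow> 'b" where
  "partial_deriv i f x = frechet_derivative f (at x) (axis i 1)"

primrec C_k :: "nat \<Rightarrow> (real^'n \<Rightarrow> 'b::real_normed_vector) \<Rightarrow> bool" where
  "C_k 0 f \<longleftrightarrow> continuous_on UNIV f"
| "C_k (Suc k) f \<longleftrightarrow> (\<forall>x. f differentiable at x) \<and> (\<forall>i. C_k k (partial_deriv i f))"

definition smooth :: "(real^'n \<Rightarrow> 'b::real_normed_vector) \<Rightarrow> bool" where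
  "smooth f \<longleftrightarrow> (\<forall>k. C_k k f)"

definition divergence :: "(real^'n \<Rightarrow> real^'n) \<Rightarrow> real^'n \<Rightarrow> real" where
  "divergence V x = (\<Sum>i\<in>UNIV. partial_deriv i V x $ i)"

definition L2_torus :: "(real^'n \<Rightarrow> 'b::real_normed_vector) set" where
  "L2_torus = {f. periodic f \<and> f \<in> borel_measurable lebesgue \<and>
                  integrable torus (\<lambda>x. (norm (f x))\<^sup>2)}"

definition has_weak_gradient :: "(real^'n \<Rightarrow> real) \<Rightarrow> (real^'n \<Rightarrow> real^'n) \<Rightarrow> bool" where
  "has_weak_gradient u G \<longleftrightarrow>
     (\<forall>\<phi> i. smooth \<phi> \<and> periodic \<phi> \<longrightarrow>
        (\<integral>x. u x * partial_deriv i \<phi> x \<partial>torus) = - (\<integral>x. G x $ i * \<phi> x \<partial>torus))"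

definition H1_torus :: "(real^'n \<Rightarrow> real) set" where
  "H1_torus = {u \<in> L2_torus. \<exists>G\<in>L2_torus. has_weak_gradient u G}"

definition H1_per :: "(real^'n \<Rightarrow> real) set" where
  "H1_per = {u \<in> H1_torus. (\<integral>x. u x \<partial>torus) = 0}"

text \<open>The weak gradient is determined only up to a null set; \<open>wgrad\<close> picks a representative,
  and is meaningful for members of \<open>H1_torus\<close>. It is used below only under integrals.\<close>

definition wgrad :: "(real^'n \<Rightarrow> real) \<Rightarrow> real^'n \<Rightarrow> real^'n" where
  "wgrad u = (SOME G. G \<in> L2_torus \<and> has_weak_gradient u G)"

definition H1_norm :: "(real^'n \<Rightarrow> real) \<Rightarrow> real" where
  "H1_norm u = sqrt ((\<integral>x. (u x)\<^sup>2 \<partial>torus) + (\<integral>x. (norm (wgrad u x))\<^sup>2 \<partial>torus))"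

text \<open>\<open>weak_solution a V f w\<close>: \<open>w\<close> is a mean zero weak solution of
  \<open>- a \<Delta> w + V \<bullet> D w = f\<close> on the torus. Test functions are not required to have mean zero.\<close>

definition weak_solution ::
  "real \<Rightarrow> (real^'n \<Rightarrow> real^'n) \<Rightarrow> (real^'n \<Rightarrow> real) \<Rightarrow> (real^'n \<Rightarrow> real) \<Rightarrow> bool" where
  "weak_solution a V f w \<longleftrightarrow> w \<in> H1_per \<and>
     (\<forall>\<phi>\<in>H1_torus.
        a * (\<integral>x. wgrad w x \<bullet> wgrad \<phi> x \<partial>torus) + (\<integral>x. (V x \<bullet> wgrad w x) * \<phi> x \<partial>torus)
        = (\<integral>x. f x * \<phi> x \<partial>torus))"

end

theory Submission
  imports Defs
begin

text \<open>Subtracting two consecutive equations and testing with \<open>w = u\<^sub>k\<^sub>+\<^sub>2 - u\<^sub>k\<^sub>+\<^sub>1\<close> gives an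
  energy estimate. The transport term \<open>\<integral> (V \<bullet> Dw) w\<close> is \<open>0\<close> because it equals
  \<open>- 1/2 \<integral> (div V) w\<^sup>2\<close> (\<open>transport_term_eq_0\<close>); the constants \<open>H k\<close> disappear because \<open>w\<close> has
  mean zero; and since the Euclidean norm is 1-Lipschitz, what remains on the right is at most
  \<open>s\<^sub>L \<parallel>D(u\<^sub>k\<^sub>+\<^sub>1 - u\<^sub>k)\<parallel> \<parallel>w\<parallel>\<close> in \<open>L\<^sup>2\<close>. The inequality \<open>\<parallel>w\<parallel> \<le> \<parallel>Dw\<parallel> / (2 pi)\<close> (\<open>Poincare\<close>) then gives
  \<open>\<parallel>Dw\<parallel> \<le> \<parallel>D(u\<^sub>k\<^sub>+\<^sub>1 - u\<^sub>k)\<parallel> / (2 pi d)\<close> (\<open>gradient_contraction\<close>). The bound on \<open>d\<close> forces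
  \<open>2 pi d > 2\<close>, so the gradients of consecutive differences decay at least like \<open>2\<^sup>-\<^sup>k\<close> and
  completeness of \<open>H\<^sup>1\<close> (\<open>H1_per_complete\<close>) yields the limit.

  The analysis behind this rests on Fourier series. The trigonometric polynomials are dense in
  \<open>L\<^sup>2\<close> (\<open>trig_poly_dense\<close>, from the Stone-Weierstrass theorem), hence the partial Fourier sums of an
  \<open>L\<^sup>2\<close> function converge to it. A partial Fourier sum of \<open>w\<close> is a smooth function whose classical
  partial derivatives are the partial Fourier sums of the weak ones
  (\<open>partial_deriv_fourier_sum\<close>). So the smooth functions needed to justify integration by parts in
  the transport term come for free, the Poincare inequality is a comparison of coefficients, and
  the weak gradient is unique because its Fourier coefficients are.\<close>

section \<open>Square integrable functions\<close>

definition square_integrable :: "'a measure \<Rightarrow> ('a \<Rightarrow> real) \<Rightarrow> bool" where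
  "square_integrable M f \<longleftrightarrow> f \<in> borel_measurable M \<and> integrable M (\<lambda>x. (f x)\<^sup>2)"

lemma square_integrable_mult:
  assumes "square_integrable M f" "square_integrable M g"
  shows "integrable M (\<lambda>x. f x * g x)"
proof (rule Bochner_Integration.integrable_bound)
  show "integrable M (\<lambda>x. (f x)\<^sup>2 + (g x)\<^sup>2)"
    using assms by (simp add: square_integrable_def)
  show "(\<lambda>x. f x * g x) \<in> borel_measurable M"
    using assms by (auto simp: square_integrable_def)
  have "\<bar>a * b\<bar> \<le> a\<^sup>2 + b\<^sup>2" for a b :: real
    using sum_squares_bound[of "\<bar>a\<bar>" "\<bar>b\<bar>"] abs_ge_zero[of "a*b"] 
    unfolding abs_mult power2_abs by linarith
  then show "AE x in M. norm (f x * g x) \<le> norm ((f x)\<^sup>2 + (g x)\<^sup>2)"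
    by (auto simp: abs_of_nonneg)
qed

lemma square_integrable_add:
  assumes "square_integrable M f" "square_integrable M g"
  shows "square_integrable M (\<lambda>x. f x + g x)"
  using assms square_integrable_mult[OF assms]
  unfolding square_integrable_def power2_sum
  by (auto simp: mult.assoc)

lemma square_integrable_cmult:
  assumes "square_integrable M f"
  shows "square_integrable M (\<lambda>x. c * f x)"
  using assms unfolding square_integrable_def power_mult_distrib by auto

lemma square_integrable_diff:
  assumes "square_integrable M f" "square_integrable M g"
  shows "square_integrable M (\<lambda>x. f x - g x)"
  using square_integrable_add[OF assms(1) square_integrable_cmult[OF assms(2), of "-1"]] by simp

lemma square_integrable_sum:
  assumes "\<And>i. i \<in> I \<Longrightarrow> square_integrable M (f i)"
  shows "square_integrable M (\<lambda>x. \<Sum>i\<in>I. f i x)"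
  using assms
proof (induction I rule: infinite_finite_induct)
  case (insert i I)
  then show ?case using square_integrable_add[of M "f i" "\<lambda>x. \<Sum>i\<in>I. f i x"] by simp
qed (auto simp: square_integrable_def)

lemma square_integrable_bounded_mult:
  assumes "square_integrable M f" "b \<in> borel_measurable M" "\<And>x. x \<in> space M \<Longrightarrow> \<bar>b x\<bar> \<le> B"
  shows "square_integrable M (\<lambda>x. b x * f x)"
  unfolding square_integrable_def
proof
  show "(\<lambda>x. b x * f x) \<in> borel_measurable M"
    using assms by (auto simp: square_integrable_def)
  show "integrable M (\<lambda>x. (b x * f x)\<^sup>2)"
  proof (rule Bochner_Integration.integrable_bound)
    show "integrable M (\<lambda>x. B\<^sup>2 * (f x)\<^sup>2)"
      using assms by (simp add: square_integrable_def)
    show "(\<lambda>x. (b x * f x)\<^sup>2) \<in> borel_measurable M"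
      using assms by (auto simp: square_integrable_def)
    have "(b x)\<^sup>2 \<le> B\<^sup>2" if "x \<in> space M" for x
      using assms(3)[OF that] by (metis abs_ge_zero power2_abs power_mono)
    then show "AE x in M. norm ((b x * f x)\<^sup>2) \<le> norm (B\<^sup>2 * (f x)\<^sup>2)"
      by (auto simp: power_mult_distrib mult_right_mono)
  qed
qed

lemma L2_Cauchy_Schwarz:
  assumes f: "square_integrable M f" and g: "square_integrable M g"
  shows "\<bar>\<integral>x. f x * g x \<partial>M\<bar> \<le> sqrt (\<integral>x. (f x)\<^sup>2 \<partial>M) * sqrt (\<integral>x. (g x)\<^sup>2 \<partial>M)"
proof -
  define A B C where "A = (\<integral>x. (f x)\<^sup>2 \<partial>M)" and "B = (\<integral>x. f x * g x \<partial>M)" and "C = (\<integral>x. (g x)\<^sup>2 \<partial>M)"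
  have C0: "C \<ge> 0" "A \<ge> 0" unfolding C_def A_def by auto
  have q: "0 \<le> s\<^sup>2 * A - 2 * s * t * B + t\<^sup>2 * C" for s t
  proof -
    have "0 \<le> (\<integral>x. (s * f x - t * g x)\<^sup>2 \<partial>M)" by simp
    also have "\<dots> = (\<integral>x. s\<^sup>2 * (f x)\<^sup>2 - 2 * s * t * (f x * g x) + t\<^sup>2 * (g x)\<^sup>2 \<partial>M)"
      by (rule Bochner_Integration.integral_cong) (auto simp: power2_eq_square algebra_simps)
    also have "\<dots> = s\<^sup>2 * A - 2 * s * t * B + t\<^sup>2 * C"
      using f g square_integrable_mult[OF f g]
      by (simp add: A_def B_def C_def square_integrable_def)
    finally show ?thesis .
  qed
  have "B\<^sup>2 \<le> A * C"
  proof (cases "C = 0")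
    case True
    have "B = 0"
    proof (rule ccontr)
      assume "B \<noteq> 0"
      then show False using q[of 1 "(A+1)/(2*B)"] True C0 by (simp add: field_simps)
    qed
    then show ?thesis using True by simp
  next
    case False
    then have "C > 0" using C0 by simp
    have "0 \<le> C * (A * C - B\<^sup>2)"
      using q[of C B] by (simp add: power2_eq_square algebra_simps)
    then show ?thesis using \<open>C > 0\<close> by (simp add: zero_le_mult_iff)
  qed
  then have "sqrt (B\<^sup>2) \<le> sqrt (A * C)" by (rule real_sqrt_le_mono)
  then show ?thesis by (simp add: A_def B_def C_def real_sqrt_mult)
qed

lemma L2_tendsto_inner:
  assumes f: "\<And>n. square_integrable M (F n)" "square_integrable M f"
      "(\<lambda>n. \<integral>x. (F n x - f x)\<^sup>2 \<partial>M) \<longlonglongrightarrow> 0"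
    and g: "\<And>n. square_integrable M (G n)" "square_integrable M g"
      "(\<lambda>n. \<integral>x. (G n x - g x)\<^sup>2 \<partial>M) \<longlonglongrightarrow> 0"
  shows "(\<lambda>n. \<integral>x. F n x * G n x \<partial>M) \<longlonglongrightarrow> (\<integral>x. f x * g x \<partial>M)"
proof -
  define a where "a n = sqrt (\<integral>x. (F n x - f x)\<^sup>2 \<partial>M)" for n
  define b where "b n = sqrt (\<integral>x. (G n x - g x)\<^sup>2 \<partial>M)" for n
  define A where "A = sqrt (\<integral>x. (f x)\<^sup>2 \<partial>M)"
  define B where "B = sqrt (\<integral>x. (g x)\<^sup>2 \<partial>M)"
  have a: "a \<longlonglongrightarrow> 0" unfolding a_def using tendsto_real_sqrt[OF f(3)] by simp
  have b: "b \<longlonglongrightarrow> 0" unfolding b_def using tendsto_real_sqrt[OF g(3)] by simp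
  have "(\<lambda>n. (\<integral>x. F n x * G n x \<partial>M) - (\<integral>x. f x * g x \<partial>M)) \<longlonglongrightarrow> 0"
  proof (rule Lim_null_comparison)
    show "(\<lambda>n. a n * b n + a n * B + A * b n) \<longlonglongrightarrow> 0"
      using tendsto_add[OF tendsto_add[OF tendsto_mult[OF a b] tendsto_mult[OF a tendsto_const[of B]]]
          tendsto_mult[OF tendsto_const[of A] b]] by simp
    show "\<forall>\<^sub>F n in sequentially. norm ((\<integral>x. F n x * G n x \<partial>M) - (\<integral>x. f x * g x \<partial>M))
             \<le> a n * b n + a n * B + A * b n"
    proof (rule always_eventually, rule allI)
      fix n
      have df: "square_integrable M (\<lambda>x. F n x - f x)" and dg: "square_integrable M (\<lambda>x. G n x - g x)"
        using f g by (auto intro: square_integrable_diff)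
      have "(\<integral>x. F n x * G n x \<partial>M) - (\<integral>x. f x * g x \<partial>M)
          = (\<integral>x. F n x * G n x - f x * g x \<partial>M)"
        using f g by (simp add: square_integrable_mult)
      also have "\<dots> = (\<integral>x. (F n x - f x) * (G n x - g x) + (F n x - f x) * g x + f x * (G n x - g x) \<partial>M)"
        by (rule Bochner_Integration.integral_cong) (auto simp: algebra_simps)
      also have "\<dots> = (\<integral>x. (F n x - f x) * (G n x - g x) \<partial>M) + (\<integral>x. (F n x - f x) * g x \<partial>M)
            + (\<integral>x. f x * (G n x - g x) \<partial>M)"
        by (intro trans[OF Bochner_Integration.integral_add] arg_cong2[where f="(+)"] refl
            Bochner_Integration.integral_add Bochner_Integration.integrable_add
            square_integrable_mult df dg f(2) g(2))
      finally show "norm ((\<integral>x. F n x * G n x \<partial>M) - (\<integral>x. f x * g x \<partial>M))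
             \<le> a n * b n + a n * B + A * b n"
        using L2_Cauchy_Schwarz[OF df dg] L2_Cauchy_Schwarz[OF df g(2)] L2_Cauchy_Schwarz[OF f(2) dg]
        by (simp add: a_def b_def A_def B_def)
    qed
  qed
  then show ?thesis by (simp add: LIM_zero_iff)
qed

lemma integral_square_triangle:
  assumes "square_integrable M f" "square_integrable M g"
  shows "(\<integral>x. (f x + g x)\<^sup>2 \<partial>M) \<le> 2 * (\<integral>x. (f x)\<^sup>2 \<partial>M) + 2 * (\<integral>x. (g x)\<^sup>2 \<partial>M)"
proof -
  have "(\<integral>x. (f x + g x)\<^sup>2 \<partial>M) \<le> (\<integral>x. 2 * (f x)\<^sup>2 + 2 * (g x)\<^sup>2 \<partial>M)"
  proof (rule integral_mono)
    show "integrable M (\<lambda>x. (f x + g x)\<^sup>2)"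
      using square_integrable_add[OF assms] by (simp add: square_integrable_def)
    show "integrable M (\<lambda>x. 2 * (f x)\<^sup>2 + 2 * (g x)\<^sup>2)"
      using assms by (simp add: square_integrable_def)
    show "(f x + g x)\<^sup>2 \<le> 2 * (f x)\<^sup>2 + 2 * (g x)\<^sup>2" for x
      using sum_squares_bound[of "f x" "g x"] by (simp add: power2_sum)
  qed
  also have "\<dots> = 2 * (\<integral>x. (f x)\<^sup>2 \<partial>M) + 2 * (\<integral>x. (g x)\<^sup>2 \<partial>M)"
    using assms by (simp add: square_integrable_def)
  finally show ?thesis .
qed

section \<open>Integration over the torus\<close>

lemma space_torus [simp]: "space (torus :: (real^'n) measure) = cbox 0 1"
  by (simp add: torus_def)

lemma measurable_torusI: "f \<in> borel_measurable lebesgue \<Longrightarrow> f \<in> borel_measurable (torus :: (real^'n) measure)"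
  unfolding torus_def by (rule measurable_restrict_space1)

lemma content_unit_cube [simp]: "measure lborel (cbox (0::real^'n) 1) = 1"
  by (subst content_cbox_cart) (auto simp: interval_ne_empty_cart)

lemma prob_space_torus: "emeasure (torus :: (real^'n) measure) (space torus) = 1"
  by (simp add: torus_def emeasure_restrict_space emeasure_eq_measure2 emeasure_lborel_cbox_eq)

lemma finite_measure_torus: "finite_measure (torus :: (real^'n) measure)"
  by (rule finite_measureI) (simp add: prob_space_torus del: space_torus)

lemma continuous_measurable_torus:
  fixes f :: "real^'n \<Rightarrow> 'b::euclidean_space"
  assumes "continuous_on UNIV f"
  shows "f \<in> borel_measurable torus"
  by (rule measurable_torusI)
    (metis assms borel_measurable_continuous_onI measurable_completion measurable_lborel2)

lemma continuous_bounded_on_cube: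
  fixes f :: "real^'n \<Rightarrow> 'b::euclidean_space"
  assumes "continuous_on UNIV f"
  obtains B where "B \<ge> 0" "\<And>x. x \<in> cbox a b \<Longrightarrow> norm (f x) \<le> B"
proof -
  have "compact (f ` cbox a b)"
    using assms by (intro compact_continuous_image) (auto intro: continuous_on_subset)
  then obtain B where "\<forall>y\<in>f ` cbox a b. norm y \<le> B"
    using compact_imp_bounded bounded_iff by blast
  then have "\<And>x. x \<in> cbox a b \<Longrightarrow> norm (f x) \<le> max B 0" by fastforce
  then show ?thesis using that[of "max B 0"] by auto
qed

lemma bounded_integrable_torus:
  fixes f :: "real^'n \<Rightarrow> 'b::euclidean_space"
  assumes "f \<in> borel_measurable torus" "\<And>x. x \<in> cbox 0 1 \<Longrightarrow> norm (f x) \<le> B"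
  shows "integrable torus f"
proof -
  interpret finite_measure "torus :: (real^'n) measure" by (rule finite_measure_torus)
  show ?thesis
    by (rule integrable_const_bound[of _ B]) (use assms in auto)
qed

lemma continuous_integrable_torus:
  fixes f :: "real^'n \<Rightarrow> 'b::euclidean_space"
  assumes "continuous_on UNIV f"
  shows "integrable torus f"
proof -
  obtain B where "\<And>x. x \<in> cbox (0::real^'n) 1 \<Longrightarrow> norm (f x) \<le> B"
    using continuous_bounded_on_cube[OF assms] by blast
  then show ?thesis
    by (intro bounded_integrable_torus continuous_measurable_torus assms)
qed

lemma continuous_square_integrable:
  fixes f :: "real^'n \<Rightarrow> real"
  assumes "continuous_on UNIV f"
  shows "square_integrable torus f"
  unfolding square_integrable_def
  using assms by (auto intro!: continuous_measurable_torus continuous_integrable_torus continuous_intros)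

lemma square_integrable_integrable:
  fixes f :: "real^'n \<Rightarrow> real"
  assumes "square_integrable torus f"
  shows "integrable torus f"
  using square_integrable_mult[OF assms continuous_square_integrable[of "\<lambda>x. 1"]] by simp

lemma measure_torus [simp]: "measure (torus :: (real^'n) measure) (cbox 0 1) = 1"
  using prob_space_torus[where 'n='n] by (simp add: measure_def)

lemma continuous_integral_torus:
  fixes f :: "real^'n \<Rightarrow> real"
  assumes "continuous_on UNIV f"
  shows "(\<integral>x. f x \<partial>torus) = integral (cbox 0 1) f"
  using continuous_integrable_torus[OF assms] unfolding torus_def
  by (simp add: lebesgue_integral_eq_integral)

lemma nth_axis: "axis i t $ j = (if j = i then t else 0)"
  by (simp add: axis_def)

lemma mem_cbox_split:
  fixes x :: "real^'n"
  shows "x \<in> cbox a b \<longleftrightarrow> (a $ i \<le> x $ i \<and> x $ i \<le> b $ i) \<and> (\<forall>j. j \<noteq> i \<longrightarrow> a $ j \<le> x $ j \<and> x $ j \<le> b $ j)"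
  unfolding mem_box_cart by metis

text \<open>Translating the cube by \<open>t\<close> along an axis removes a slab of height \<open>t\<close> at the bottom and adds one at
  the top; the two slabs are integer translates of each other, so periodicity equates their
  integrals.\<close>

lemma integral_torus_shift:
  fixes f :: "real^'n \<Rightarrow> real"
  assumes f: "continuous_on UNIV f" "periodic f" and t: "0 \<le> t" "t \<le> 1"
  shows "(\<integral>x. f (x + axis i t) \<partial>torus) = (\<integral>x. f x \<partial>torus)"
proof -
  have ci: "f integrable_on cbox a b" for a b
    by (rule integrable_continuous) (use f(1) continuous_on_subset in blast)
  have ax: "axis i (1::real) \<in> Basis" by (simp add: axis_in_Basis_iff)
  have "(\<integral>x. f (x + axis i t) \<partial>torus) = integral (cbox 0 1) (\<lambda>x. f (x + axis i t))"
    by (rule continuous_integral_torus) (auto intro!: continuous_intros continuous_on_compose2[OF f(1)])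
  also have "\<dots> = integral (cbox (axis i t) (1 + axis i t)) f"
    using integral_shift_cbox[of "axis i t" "axis i t" "1 + axis i t" f] by simp
  also have "\<dots> = integral (cbox (axis i t) (1 + axis i t) \<inter> {x. x \<bullet> axis i 1 \<le> 1}) f
       + integral (cbox (axis i t) (1 + axis i t) \<inter> {x. x \<bullet> axis i 1 \<ge> 1}) f"
    by (rule integral_split[OF ci ax])
  also have "cbox (axis i t) (1 + axis i t) \<inter> {x. x \<bullet> axis i 1 \<le> 1} = cbox 0 1 \<inter> {x. x \<bullet> axis i 1 \<ge> t}"
    using t by (intro set_eqI) (auto simp: mem_cbox_split[of _ _ _ i] inner_axis nth_axis)
  also have "cbox (axis i t) (1 + axis i t) \<inter> {x. x \<bullet> axis i 1 \<ge> 1}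
      = cbox (0 + axis i 1) (1 - axis i 1 + axis i t + axis i 1)"
    using t by (intro set_eqI) (auto simp: mem_cbox_split[of _ _ _ i] inner_axis nth_axis)
  also have "integral (cbox (0 + axis i 1) (1 - axis i 1 + axis i t + axis i 1)) f
      = integral (cbox 0 (1 - axis i 1 + axis i t)) (\<lambda>x. f (x + axis i 1))"
    using integral_shift_cbox[of "0 + axis i 1" "axis i 1" "1 - axis i 1 + axis i t + axis i 1" f]
    by (simp add: algebra_simps)
  also have "(\<lambda>x. f (x + axis i 1)) = f"
    using f(2) unfolding periodic_def by (auto simp: axis_def)
  also have "cbox 0 (1 - axis i 1 + axis i t) = cbox 0 1 \<inter> {x. x \<bullet> axis i 1 \<le> t}"
    using t by (intro set_eqI) (auto simp: mem_cbox_split[of _ _ _ i] inner_axis nth_axis)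
  also have "integral (cbox 0 1 \<inter> {x. t \<le> x \<bullet> axis i 1}) f + integral (cbox 0 1 \<inter> {x. x \<bullet> axis i 1 \<le> t}) f
     = integral (cbox 0 1) f"
    using integral_split[OF ci ax, of 0 1 t] by simp
  also have "\<dots> = (\<integral>x. f x \<partial>torus)"
    by (rule continuous_integral_torus[symmetric]) fact
  finally show ?thesis .
qed

lemma has_partial_deriv:
  fixes f :: "real^'n \<Rightarrow> real"
  assumes "f differentiable at (x + axis i t)"
  shows "((\<lambda>t. f (x + axis i t)) has_real_derivative partial_deriv i f (x + axis i t)) (at t)"
proof -
  have d: "(f has_derivative frechet_derivative f (at (x + axis i t))) (at (x + axis i t))"
    using assms frechet_derivative_works by blast
  have sc: "axis i s = s *\<^sub>R axis i (1::real)" for s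
    by (simp add: vec_eq_iff axis_def)
  have "((\<lambda>t. x + axis i t) has_derivative (\<lambda>s. axis i s)) (at t)"
    by (subst (1 2) sc) (auto intro!: derivative_eq_intros)
  from diff_chain_at[OF this d]
  have "((\<lambda>t. f (x + axis i t)) has_derivative (\<lambda>s. frechet_derivative f (at (x + axis i t)) (axis i s))) (at t)"
    by (simp add: o_def)
  moreover have "frechet_derivative f (at (x + axis i t)) (axis i s) = partial_deriv i f (x + axis i t) * s" for s
    unfolding partial_deriv_def
    using linear_frechet_derivative[OF assms] by (subst sc) (simp add: linear_cmul mult.commute)
  ultimately show ?thesis
    by (simp add: has_field_derivative_def)
qed

text \<open>This is the divergence theorem on the torus, for one coordinate. The difference quotients along
  axis \<open>i\<close> have integral zero by translation invariance, and they converge boundedly to the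
  partial derivative.\<close>

lemma integral_partial_deriv_eq_0:
  fixes f :: "real^'n \<Rightarrow> real"
  assumes d: "\<And>x. f differentiable at x" and c: "continuous_on UNIV (partial_deriv i f)"
    and p: "periodic f"
  shows "(\<integral>x. partial_deriv i f x \<partial>torus) = 0"
proof -
  have cf: "continuous_on UNIV f"
    using d by (simp add: continuous_at_imp_continuous_on differentiable_imp_continuous_within)
  define h where "h n = 1 / real (Suc n)" for n
  have h: "0 < h n" "h n \<le> 1" for n by (auto simp: h_def)
  have h0: "h \<longlonglongrightarrow> 0" unfolding h_def using LIMSEQ_inverse_real_of_nat by (simp add: inverse_eq_divide)
  define s where "s n x = (f (x + axis i (h n)) - f x) / h n" for n x
  have cs: "continuous_on UNIV (s n)" for n
    unfolding s_def using h[of n] by (auto intro!: continuous_intros continuous_on_compose2[OF cf])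
  \<comment> \<open>The mean value theorem evaluates the derivative up to one unit outside the unit cube.\<close>
  obtain B where B: "B \<ge> 0" "\<And>x. x \<in> cbox (0::real^'n) 2 \<Longrightarrow> norm (partial_deriv i f x) \<le> B"
    using continuous_bounded_on_cube[OF c] by blast
  have "(\<lambda>n. \<integral>x. s n x \<partial>torus) \<longlonglongrightarrow> (\<integral>x. partial_deriv i f x \<partial>torus)"
  proof (rule integral_dominated_convergence[where w="\<lambda>x. B"])
    show "partial_deriv i f \<in> borel_measurable torus" by (rule continuous_measurable_torus) fact
    show "s n \<in> borel_measurable torus" for n by (rule continuous_measurable_torus) fact
    show "integrable torus (\<lambda>x::real^'n. B)"
      by (rule continuous_integrable_torus) auto
    show "AE x in torus. (\<lambda>n. s n x) \<longlonglongrightarrow> partial_deriv i f x"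
    proof (rule AE_I2)
      fix x :: "real^'n"
      have z: "axis i 0 = (0::real^'n)" by (simp add: vec_eq_iff axis_def)
      have "((\<lambda>t. (f (x + axis i t) - f x) / t) \<longlongrightarrow> partial_deriv i f x) (at 0)"
        using has_partial_deriv[OF d, of x i 0] unfolding DERIV_def z by simp
      moreover have "filterlim h (at 0) sequentially"
        unfolding filterlim_at using h0 h by (auto simp: less_imp_neq[THEN not_sym])
      ultimately show "(\<lambda>n. s n x) \<longlonglongrightarrow> partial_deriv i f x"
        unfolding s_def by (rule filterlim_compose)
    qed
    show "AE x in torus. norm (s n x) \<le> B" for n
    proof (rule AE_I2)
      fix x :: "real^'n" assume x: "x \<in> space torus"
      obtain z where z: "0 < z" "z < h n" "f (x + axis i (h n)) - f (x + axis i 0) = (h n - 0) * partial_deriv i f (x + axis i z)"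
        using MVT2[of 0 "h n" "\<lambda>t. f (x + axis i t)" "\<lambda>t. partial_deriv i f (x + axis i t)"]
          has_partial_deriv[OF d] h by blast
      have z0: "axis i 0 = (0::real^'n)" by (simp add: vec_eq_iff axis_def)
      have "s n x = partial_deriv i f (x + axis i z)"
        using z h[of n] unfolding s_def z0 by simp
      moreover have "x + axis i z \<in> cbox 0 2"
      proof -
        have "0 \<le> x $ j \<and> x $ j \<le> 1" for j using x by (auto simp: mem_box_cart)
        moreover have "0 \<le> axis i z $ j \<and> axis i z $ j \<le> 1" for j using z h[of n] by (auto simp: axis_def)
        ultimately show ?thesis by (auto simp: mem_box_cart) (smt (verit))
      qed
      ultimately show "norm (s n x) \<le> B" using B by auto
    qed
  qed
  moreover have "(\<integral>x. s n x \<partial>torus) = 0" for n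
  proof -
    have "integrable torus (\<lambda>x. f (x + axis i (h n)))"
      by (rule continuous_integrable_torus) (auto intro!: continuous_intros continuous_on_compose2[OF cf])
    then have "(\<integral>x. s n x \<partial>torus) = ((\<integral>x. f (x + axis i (h n)) \<partial>torus) - (\<integral>x. f x \<partial>torus)) / h n"
      unfolding s_def using continuous_integrable_torus[OF cf] by simp
    then show ?thesis
      using integral_torus_shift[OF cf p, of "h n" i] h[of n] by simp
  qed
  ultimately show ?thesis
    by (metis LIMSEQ_unique tendsto_const ext)
qed


section \<open>Trigonometric polynomials\<close>

definition integer_vectors :: "(real^'n) set" where
  "integer_vectors = {m. \<forall>i. m $ i \<in> \<int>}"

text \<open>A real phase replaces the distinction between sines and cosines: \<open>\<theta> = 0\<close> gives the cosine,
  \<open>\<theta> = - pi/2\<close> the sine, and differentiation is a shift of the phase by \<open>pi/2\<close>.\<close>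

definition wave :: "real^'n \<Rightarrow> real \<Rightarrow> real^'n \<Rightarrow> real" where
  "wave m \<theta> x = cos (2 * pi * (m \<bullet> x) + \<theta>)"

lemma integer_vectors_closed:
  "0 \<in> integer_vectors"
  "m \<in> integer_vectors \<Longrightarrow> k \<in> integer_vectors \<Longrightarrow> m + k \<in> integer_vectors"
  "m \<in> integer_vectors \<Longrightarrow> k \<in> integer_vectors \<Longrightarrow> m - k \<in> integer_vectors"
  "m \<in> integer_vectors \<Longrightarrow> - m \<in> integer_vectors"
  "axis i 1 \<in> integer_vectors"
  by (auto simp: integer_vectors_def nth_axis)

lemma continuous_wave: "continuous_on A (wave m \<theta>)"
  unfolding wave_def by (intro continuous_intros)

lemma square_integrable_wave: "square_integrable torus (wave m \<theta>)"
  by (rule continuous_square_integrable[OF continuous_wave])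

lemma periodic_wave:
  fixes m :: "real^'n"
  assumes "m \<in> integer_vectors"
  shows "periodic (wave m \<theta>)"
  unfolding periodic_def
proof (intro allI impI)
  fix x k :: "real^'n" assume k: "\<forall>i. k $ i \<in> \<int>"
  have "m \<bullet> k \<in> \<int>"
    using assms k by (auto simp: inner_vec_def integer_vectors_def)
  then obtain z where z: "m \<bullet> k = of_int z" by (auto elim: Ints_cases)
  have "2 * pi * (m \<bullet> (x + k)) + \<theta> = (2 * pi * (m \<bullet> x) + \<theta>) + of_int z * (2 * pi)"
    by (simp add: inner_add_right z algebra_simps)
  then show "wave m \<theta> (x + k) = wave m \<theta> x"
    unfolding wave_def by (metis cos.plus_of_int of_real_eq_id id_apply)
qed

lemma wave_has_derivative:
  "((\<lambda>x. c * wave m \<theta> x) has_derivative (\<lambda>h. c * (2 * pi) * (m \<bullet> h) * wave m (\<theta> + pi/2) x)) (at x)"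
proof -
  have "wave m (\<theta> + pi/2) x = - sin (2 * pi * (m \<bullet> x) + \<theta>)"
    unfolding wave_def by (simp add: cos_add sin_add)
  then show ?thesis
    unfolding wave_def
    by (auto intro!: derivative_eq_intros)
qed

lemma partial_deriv_wave:
  "partial_deriv i (\<lambda>x. c * wave m \<theta> x) = (\<lambda>x. (c * (2 * pi) * m $ i) * wave m (\<theta> + pi/2) x)"
  unfolding partial_deriv_def
  by (rule ext) (simp add: frechet_derivative_at[OF wave_has_derivative, symmetric] inner_axis)

lemma smooth_wave: "smooth (\<lambda>x. c * wave m \<theta> x)"
proof -
  have "C_k k (\<lambda>x. c * wave m \<theta> x)" for k
  proof (induction k arbitrary: c \<theta>)
    case 0
    then show ?case by (auto intro!: continuous_intros continuous_wave)
  next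
    case (Suc k)
    have "(\<lambda>x. c * wave m \<theta> x) differentiable at x" for x
      using wave_has_derivative differentiable_def by blast
    then show ?case using Suc by (simp only: C_k.simps partial_deriv_wave) auto
  qed
  then show ?thesis by (simp add: smooth_def)
qed

lemma integral_wave:
  assumes m: "m \<in> integer_vectors"
  shows "(\<integral>x. wave m \<theta> x \<partial>torus) = (if m = 0 then cos \<theta> else 0)"
proof (cases "m = 0")
  case True
  then show ?thesis by (simp add: wave_def)
next
  case False
  then obtain i where i: "m $ i \<noteq> 0" by (auto simp: vec_eq_iff)
  define c where "c = 1 / (2 * pi * m $ i)"
  have p: "partial_deriv i (\<lambda>x. c * wave m (\<theta> - pi/2) x) = wave m \<theta>"
    unfolding partial_deriv_wave using i by (simp add: c_def)
  have "(\<integral>x. partial_deriv i (\<lambda>x. c * wave m (\<theta> - pi/2) x) x \<partial>torus) = 0"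
  proof (rule integral_partial_deriv_eq_0)
    show "(\<lambda>x. c * wave m (\<theta> - pi/2) x) differentiable at x" for x
      using wave_has_derivative differentiable_def by blast
    show "continuous_on UNIV (partial_deriv i (\<lambda>x. c * wave m (\<theta> - pi / 2) x))"
      unfolding p by (rule continuous_wave)
    show "periodic (\<lambda>x. c * wave m (\<theta> - pi / 2) x)"
      using periodic_wave[OF m] by (auto simp: periodic_def)
  qed
  then show ?thesis using False unfolding p by simp
qed

lemma wave_mult:
  "wave m \<alpha> x * wave k \<beta> x = wave (m + k) (\<alpha> + \<beta>) x / 2 + wave (m - k) (\<alpha> - \<beta>) x / 2"
proof -
  have "wave m \<alpha> x * wave k \<beta> x = (cos ((2 * pi * (m \<bullet> x) + \<alpha>) - (2 * pi * (k \<bullet> x) + \<beta>))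
      + cos ((2 * pi * (m \<bullet> x) + \<alpha>) + (2 * pi * (k \<bullet> x) + \<beta>))) / 2"
    unfolding wave_def by (rule cos_times_cos)
  also have "(2 * pi * (m \<bullet> x) + \<alpha>) - (2 * pi * (k \<bullet> x) + \<beta>) = 2 * pi * ((m - k) \<bullet> x) + (\<alpha> - \<beta>)"
    by (simp add: inner_diff_left algebra_simps)
  also have "(2 * pi * (m \<bullet> x) + \<alpha>) + (2 * pi * (k \<bullet> x) + \<beta>) = 2 * pi * ((m + k) \<bullet> x) + (\<alpha> + \<beta>)"
    by (simp add: inner_add_left algebra_simps)
  finally show ?thesis by (simp add: wave_def)
qed

lemma integral_wave_mult:
  fixes m k :: "real^'n"
  assumes "m \<in> integer_vectors" "k \<in> integer_vectors"
  shows "(\<integral>x. wave m \<alpha> x * wave k \<beta> x \<partial>torus)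
    = (if m = - k then cos (\<alpha> + \<beta>) / 2 else 0) + (if m = k then cos (\<alpha> - \<beta>) / 2 else 0)"
proof -
  have i: "integrable torus (wave l \<gamma>)" for l :: "real^'n" and \<gamma>
    by (rule continuous_integrable_torus[OF continuous_wave])
  have "(\<integral>x. wave m \<alpha> x * wave k \<beta> x \<partial>torus)
     = (\<integral>x. wave (m + k) (\<alpha> + \<beta>) x \<partial>torus) / 2 + (\<integral>x. wave (m - k) (\<alpha> - \<beta>) x \<partial>torus) / 2"
    unfolding wave_mult using i by simp
  also have "\<dots> = (if m + k = 0 then cos (\<alpha> + \<beta>) / 2 else 0) + (if m - k = 0 then cos (\<alpha> - \<beta>) / 2 else 0)"
    using assms by (simp only: integral_wave integer_vectors_closed) simp
  finally show ?thesis by (simp add: eq_neg_iff_add_eq_0)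
qed

text \<open>The set \<open>F\<close> of admitted frequencies is a parameter because the density theorem needs all integer
  vectors, whereas the Fourier projection needs a finite set.\<close>

inductive trig_poly :: "(real^'n) set \<Rightarrow> (real^'n \<Rightarrow> real) \<Rightarrow> bool" for F where
  zero: "trig_poly F (\<lambda>x. 0)"
| wave: "m \<in> F \<Longrightarrow> trig_poly F p \<Longrightarrow> trig_poly F (\<lambda>x. c * wave m \<theta> x + p x)"

lemma trig_poly_wave: "m \<in> F \<Longrightarrow> trig_poly F (\<lambda>x. c * wave m \<theta> x)"
  using trig_poly.wave[OF _ trig_poly.zero] by fastforce

lemma trig_poly_const: "trig_poly integer_vectors (\<lambda>x. c)"
  using trig_poly_wave[of 0 integer_vectors c 0] by (simp add: integer_vectors_closed wave_def)

lemma trig_poly_add: "trig_poly F p \<Longrightarrow> trig_poly F q \<Longrightarrow> trig_poly F (\<lambda>x. p x + q x)"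
  by (induction rule: trig_poly.induct) (auto simp: add.assoc intro: trig_poly.intros)

lemma trig_poly_sum: "(\<And>i. i \<in> I \<Longrightarrow> trig_poly F (p i)) \<Longrightarrow> trig_poly F (\<lambda>x. \<Sum>i\<in>I. p i x)"
  by (induction I rule: infinite_finite_induct) (auto intro: trig_poly.zero trig_poly_add)

lemma trig_poly_wave_mult:
  assumes m: "m \<in> integer_vectors" and p: "trig_poly integer_vectors p"
  shows "trig_poly integer_vectors (\<lambda>x. c * wave m \<theta> x * p x)"
  using p
proof induction
  case zero
  then show ?case by (simp add: trig_poly.zero)
next
  case (wave k p d \<gamma>)
  have eq: "c * wave m \<theta> x * (d * wave k \<gamma> x + p x) = (c * d / 2) * wave (m + k) (\<theta> + \<gamma>) x +
     ((c * d / 2) * wave (m - k) (\<theta> - \<gamma>) x + c * wave m \<theta> x * p x)" for x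
  proof -
    have "c * wave m \<theta> x * (d * wave k \<gamma> x + p x) = c * d * (wave m \<theta> x * wave k \<gamma> x) + c * wave m \<theta> x * p x"
      by (simp add: algebra_simps)
    then show ?thesis unfolding wave_mult by (simp add: algebra_simps)
  qed
  show ?case
    unfolding eq using wave m by (intro trig_poly.wave integer_vectors_closed) auto
qed

lemma trig_poly_mult:
  assumes "trig_poly integer_vectors p" "trig_poly integer_vectors q"
  shows "trig_poly integer_vectors (\<lambda>x. p x * q x)"
  using assms(1)
proof induction
  case zero
  then show ?case by (simp add: trig_poly.zero)
next
  case (wave m p c \<theta>)
  then show ?case
    using trig_poly_add[OF trig_poly_wave_mult[OF wave(1) assms(2), of c \<theta>] wave(3)]
    by (simp add: algebra_simps)
qed

lemma trig_poly_mono: "trig_poly F p \<Longrightarrow> F \<subseteq> F' \<Longrightarrow> trig_poly F' p"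
  by (induction rule: trig_poly.induct) (auto intro: trig_poly.intros)

lemma trig_poly_finite_frequencies:
  "trig_poly F p \<Longrightarrow> \<exists>F'. finite F' \<and> F' \<subseteq> F \<and> trig_poly F' p"
proof (induction rule: trig_poly.induct)
  case zero
  then show ?case by (auto intro!: exI[of _ "{}"] trig_poly.zero)
next
  case (wave m p c \<theta>)
  then obtain F' where "finite F'" "F' \<subseteq> F" "trig_poly F' p" by blast
  then show ?case using wave(1)
    by (intro exI[of _ "insert m F'"]) (auto intro!: trig_poly.wave intro: trig_poly_mono)
qed

lemma continuous_trig_poly: "trig_poly F p \<Longrightarrow> continuous_on UNIV p"
  by (induction rule: trig_poly.induct) (auto intro!: continuous_intros continuous_wave)

section \<open>Density of trigonometric polynomials\<close>

text \<open>The map \<open>E\<close> wraps the cube onto a compact product of circles \<open>T\<close>. A continuous function that vanishes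
  on the boundary of the cube is compatible with the identifications made by \<open>E\<close>, hence descends to
  a continuous function on \<open>T\<close>. The coordinates of \<open>T\<close> separate points and pull back to waves, so
  the Stone-Weierstrass theorem applies there.\<close>

lemma trig_poly_uniform_approx:
  fixes g :: "real^'n \<Rightarrow> real"
  assumes g: "continuous_on UNIV g" and supp: "\<And>x. x \<notin> box 0 1 \<Longrightarrow> g x = 0" and e: "e > 0"
  obtains p where "trig_poly integer_vectors p" "\<And>x. x \<in> cbox 0 1 \<Longrightarrow> \<bar>g x - p x\<bar> < e"
proof -
  define E :: "real^'n \<Rightarrow> complex^'n" where "E x = (\<chi> i. cis (2 * pi * x $ i))" for x
  define T where "T = E ` cbox 0 1"
  have cE: "continuous_on A E" for A
    unfolding E_def cis_conv_exp by (intro continuous_intros)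
  have gE: "g x = g y" if "x \<in> cbox 0 1" "y \<in> cbox 0 1" "E x = E y" for x y
  proof (cases "x = y")
    case False
    then obtain j where j: "x $ j \<noteq> y $ j" by (auto simp: vec_eq_iff)
    have "cis (2 * pi * x $ j) = cis (2 * pi * y $ j)"
      using that(3) by (metis (no_types, lifting) E_def vec_lambda_beta)
    then have "cos (2 * pi * x $ j) = cos (2 * pi * y $ j) \<and> sin (2 * pi * x $ j) = sin (2 * pi * y $ j)"
      by (simp add: complex_eq_iff)
    then obtain z :: int where z: "2 * pi * x $ j = 2 * pi * y $ j + 2 * pi * z"
      using sin_cos_eq_iff by blast
    then have xz: "2 * pi * (x $ j) = 2 * pi * (y $ j + z)" by (simp only: distrib_left)
    then have xz: "x $ j = y $ j + z" by simp
    have b: "0 \<le> x $ j" "x $ j \<le> 1" "0 \<le> y $ j" "y $ j \<le> 1"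
      using that by (auto simp: mem_box_cart)
    then have "of_int z \<le> (1::real)" "of_int z \<ge> (-1::real)" "z \<noteq> 0" using xz j by auto
    then have "z = 1 \<or> z = -1" by auto
    then have "(x $ j = 0 \<or> x $ j = 1) \<and> (y $ j = 0 \<or> y $ j = 1)" using xz b by auto
    then have "x \<notin> box 0 1" "y \<notin> box 0 1" by (auto simp: mem_box_cart) (metis less_irrefl)+
    then show ?thesis using supp by simp
  qed simp
  define G where "G z = g (SOME x. x \<in> cbox 0 1 \<and> E x = z)" for z
  have G: "G (E x) = g x" if "x \<in> cbox 0 1" for x
  proof -
    have "(SOME y. y \<in> cbox 0 1 \<and> E y = E x) \<in> cbox 0 1 \<and> E (SOME y. y \<in> cbox 0 1 \<and> E y = E x) = E x"
      by (rule someI[of _ x]) (use that in auto)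
    then show ?thesis unfolding G_def using gE that by blast
  qed
  have cT: "compact T" unfolding T_def by (intro compact_continuous_image cE) auto
  have cG: "continuous_on T G"
    unfolding continuous_openin_preimage_eq
  proof (intro allI impI)
    fix U :: "real set" assume U: "open U"
    have "openin (top_of_set (cbox 0 1)) (cbox 0 1 \<inter> g -` U)"
      using U g by (metis continuous_on_subset subset_UNIV continuous_openin_preimage_gen)
    moreover have "x \<in> g -` U \<longleftrightarrow> x \<in> E -` (T \<inter> G -` U)" if "x \<in> cbox 0 1" for x
      using G[OF that] imageI[OF that, of E] by (simp add: T_def)
    then have "cbox 0 1 \<inter> g -` U = cbox 0 1 \<inter> E -` (T \<inter> G -` U)" by blast
    ultimately show "openin (top_of_set T) (T \<inter> G -` U)"
      using Abstract_Topology_2.continuous_imp_quotient_map[OF cE T_def[symmetric], of "T \<inter> G -` U"] by auto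
  qed
  have coord: "trig_poly integer_vectors (\<lambda>x. Re (E x $ j))" "trig_poly integer_vectors (\<lambda>x. Im (E x $ j))" for j
  proof -
    have "(\<lambda>x. Re (E x $ j)) = (\<lambda>x. 1 * wave (axis j 1) 0 x)" 
         "(\<lambda>x. Im (E x $ j)) = (\<lambda>x. 1 * wave (axis j 1) (-(pi/2)) x)"
      by (auto simp: E_def wave_def inner_axis' cos_diff)
    then show "trig_poly integer_vectors (\<lambda>x. Re (E x $ j))" "trig_poly integer_vectors (\<lambda>x. Im (E x $ j))"
      by (metis trig_poly_wave integer_vectors_closed(5))+
  qed
  let ?P = "\<lambda>h. continuous_on T h \<and> trig_poly integer_vectors (\<lambda>x. h (E x))"
  have "\<exists>h. ?P h \<and> (\<forall>z\<in>T. \<bar>G z - h z\<bar> < e)"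
  proof (rule Stone_Weierstrass_HOL[OF cT _ _ _ _ _ cG e])
    show "?P (\<lambda>x. c)" for c by (simp add: trig_poly_const)
    show "continuous_on T f" if "?P f" for f using that by simp
    show "?P (\<lambda>x. f x + h x)" if "?P f \<and> ?P h" for f h
      using that by (simp add: trig_poly_add continuous_on_add)
    show "?P (\<lambda>x. f x * h x)" if "?P f \<and> ?P h" for f h
      using that by (simp add: trig_poly_mult continuous_on_mult)
    show "\<exists>f. ?P f \<and> f z \<noteq> f w" if zw: "z \<in> T \<and> w \<in> T \<and> z \<noteq> w" for z w
    proof -
      obtain j where "z $ j \<noteq> w $ j" using zw by (auto simp: vec_eq_iff)
      then consider "Re (z $ j) \<noteq> Re (w $ j)" | "Im (z $ j) \<noteq> Im (w $ j)" by (auto simp: complex_eq_iff)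
      then show ?thesis
      proof cases
        case 1
        then show ?thesis using coord(1)[of j]
          by (intro exI[of _ "\<lambda>z. Re (z $ j)"]) (auto intro!: continuous_intros)
      next
        case 2
        then show ?thesis using coord(2)[of j]
          by (intro exI[of _ "\<lambda>z. Im (z $ j)"]) (auto intro!: continuous_intros)
      qed
    qed
  qed
  then obtain h where h: "trig_poly integer_vectors (\<lambda>x. h (E x))" "\<forall>z\<in>T. \<bar>G z - h z\<bar> < e" by blast
  show ?thesis
    by (rule that[OF h(1)]) (use h(2) G in \<open>auto simp: T_def\<close>)
qed

lemma AE_torus_not_negligible:
  assumes "negligible N"
  shows "AE x in (torus :: (real^'n) measure). x \<notin> N"
proof -
  have "AE x in lebesgue. x \<notin> N"
    using assms negligible_iff_null_sets AE_not_in by blast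
  then show ?thesis
    unfolding torus_def by (subst AE_restrict_space_iff) auto
qed

text \<open>A measurable function is the limit almost everywhere of continuous ones. Clipping these to the
  range of \<open>f\<close> makes dominated convergence applicable, and a cutoff that vanishes outside the open cube
  makes the uniform approximation above applicable.\<close>

lemma trig_poly_dense_bounded:
  fixes f :: "real^'n \<Rightarrow> real"
  assumes m: "f \<in> borel_measurable torus" and B: "\<And>x. \<bar>f x\<bar> \<le> B" and e: "e > 0"
  obtains p where "trig_poly integer_vectors p" "(\<integral>x. (f x - p x)\<^sup>2 \<partial>torus) < e"
proof -
  have "f measurable_on cbox 0 1"
    using m by (simp add: torus_def measurable_on_iff_borel_measurable)
  then obtain N g where N: "negligible N" and cg: "\<And>n. continuous_on UNIV (g n)"
    and lim: "\<And>x. x \<notin> N \<Longrightarrow> (\<lambda>n. g n x) \<longlonglongrightarrow> (if x \<in> cbox 0 1 then f x else 0)"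
    unfolding measurable_on_def by blast
  have B0: "B \<ge> 0" using B[of 0] by linarith
  let ?C = "- box 0 (1::real^'n)"
  have C0: "0 \<in> ?C" by (simp add: mem_box_cart)
  have C: "closed ?C" "?C \<noteq> {}"
    using C0 by (auto simp: closed_def open_box)
  define h where "h n x = min 1 (real n * infdist x ?C) * max (-B) (min B (g n x))" for n x
  have hB: "\<bar>h n x\<bar> \<le> B" for n x
  proof -
    have "\<bar>h n x\<bar> \<le> 1 * B"
      unfolding h_def abs_mult using B0 infdist_nonneg[of x ?C] by (intro mult_mono) auto
    then show ?thesis by simp
  qed
  have ch: "continuous_on UNIV (h n)" for n
    unfolding h_def by (intro continuous_intros cg)
  have h0: "h n x = 0" if "x \<notin> box 0 1" for n x
    unfolding h_def using that by simp
  have hlim: "(\<lambda>n. h n x) \<longlonglongrightarrow> f x" if "x \<notin> N" "x \<in> box 0 1" for x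
  proof -
    have xc: "x \<in> cbox 0 1" using that box_subset_cbox by blast
    have d: "infdist x ?C > 0"
      using C that in_closed_iff_infdist_zero[OF C, of x] infdist_nonneg[of x ?C] by fastforce
    have "\<forall>\<^sub>F n in sequentially. real n \<ge> 1 / infdist x ?C"
      by (meson eventually_sequentiallyI nat_ceiling_le_eq)
    then have "\<forall>\<^sub>F n in sequentially. 1 = min 1 (real n * infdist x ?C)"
      by eventually_elim (use d in \<open>simp add: field_simps\<close>)
    then have "(\<lambda>n. min 1 (real n * infdist x ?C)) \<longlonglongrightarrow> 1" 
      by (rule Lim_transform_eventually[OF tendsto_const])
    then have "(\<lambda>n. h n x) \<longlonglongrightarrow> 1 * max (-B) (min B (f x))"
      unfolding h_def using lim[OF that(1)] xc by (intro tendsto_intros) auto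
    then show ?thesis using B[of x] by (simp add: abs_le_iff)
  qed
  have "(\<lambda>n. \<integral>x. (f x - h n x)\<^sup>2 \<partial>torus) \<longlonglongrightarrow> (\<integral>x. 0 \<partial>(torus :: (real^'n) measure))"
  proof (rule integral_dominated_convergence[where w="\<lambda>x. (2 * B)\<^sup>2"])
    show "(\<lambda>x. 0) \<in> borel_measurable torus" by simp
    show "integrable torus (\<lambda>x::real^'n. (2 * B)\<^sup>2)" by (rule continuous_integrable_torus) auto
    show "(\<lambda>x. (f x - h n x)\<^sup>2) \<in> borel_measurable torus" for n
      using m continuous_measurable_torus[OF ch] by auto
    show "AE x in torus. (\<lambda>n. (f x - h n x)\<^sup>2) \<longlonglongrightarrow> 0"
      using AE_torus_not_negligible[OF N] AE_torus_not_negligible[OF negligible_frontier_interval[of 0 1]] AE_space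
    proof eventually_elim
      case (elim x)
      then have "(\<lambda>n. (f x - h n x)\<^sup>2) \<longlonglongrightarrow> (f x - f x)\<^sup>2"
        by (intro tendsto_intros hlim) auto
      then show ?case by simp
    qed
    show "AE x in torus. norm ((f x - h n x)\<^sup>2) \<le> (2 * B)\<^sup>2" for n
    proof (rule AE_I2)
      fix x
      have "\<bar>f x - h n x\<bar> \<le> 2 * B" using B[of x] hB[of n x] by linarith
      then show "norm ((f x - h n x)\<^sup>2) \<le> (2 * B)\<^sup>2" 
        using power_mono[of "\<bar>f x - h n x\<bar>" "2 * B" 2] by simp
    qed
  qed
  then have "\<forall>\<^sub>F n in sequentially. (\<integral>x. (f x - h n x)\<^sup>2 \<partial>torus) < e / 4"
    using e by (intro order_tendstoD) auto
  then obtain n where n: "(\<integral>x. (f x - h n x)\<^sup>2 \<partial>torus) < e / 4"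
    using eventually_happens'[OF sequentially_bot] by blast
  obtain p where p: "trig_poly integer_vectors p" "\<And>x. x \<in> cbox 0 1 \<Longrightarrow> \<bar>h n x - p x\<bar> < sqrt (e / 4)"
    using trig_poly_uniform_approx[OF ch h0, of "sqrt (e/4)" n] e by auto
  have sf: "square_integrable torus f"
    unfolding square_integrable_def
  proof
    have "(f x)\<^sup>2 \<le> B\<^sup>2" for x using B[of x] by (metis abs_ge_zero power2_abs power_mono)
    then show "integrable torus (\<lambda>x. (f x)\<^sup>2)"
      using m by (intro bounded_integrable_torus[where B="B\<^sup>2"]) auto
  qed fact
  have sh: "square_integrable torus (h n)" by (rule continuous_square_integrable[OF ch])
  have sp: "square_integrable torus p" by (rule continuous_square_integrable[OF continuous_trig_poly[OF p(1)]])
  have "(\<integral>x. (f x - p x)\<^sup>2 \<partial>torus) = (\<integral>x. ((f x - h n x) + (h n x - p x))\<^sup>2 \<partial>torus)"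
    by simp
  also have "\<dots> \<le> 2 * (\<integral>x. (f x - h n x)\<^sup>2 \<partial>torus) + 2 * (\<integral>x. (h n x - p x)\<^sup>2 \<partial>torus)"
    by (intro integral_square_triangle square_integrable_diff sf sh sp)
  also have "(\<integral>x. (h n x - p x)\<^sup>2 \<partial>torus) \<le> (\<integral>x. e / 4 \<partial>(torus :: (real^'n) measure))"
  proof (rule integral_mono)
    show "integrable torus (\<lambda>x. (h n x - p x)\<^sup>2)"
      using square_integrable_diff[OF sh sp] by (simp add: square_integrable_def)
    show "integrable torus (\<lambda>x::real^'n. e / 4)" by (rule continuous_integrable_torus) auto
    show "(h n x - p x)\<^sup>2 \<le> e / 4" if "x \<in> space torus" for x
      using p(2)[of x] that e power_mono[of "\<bar>h n x - p x\<bar>" "sqrt (e/4)" 2] by auto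
  qed
  also have "\<dots> = e / 4" by simp
  finally have "(\<integral>x. (f x - p x)\<^sup>2 \<partial>torus) < e" using n by simp
  then show ?thesis using that p(1) by blast
qed

text \<open>Truncation reduces the claim to bounded functions.\<close>

theorem trig_poly_dense:
  fixes f :: "real^'n \<Rightarrow> real"
  assumes f: "square_integrable torus f" and e: "e > 0"
  obtains p where "trig_poly integer_vectors p" "(\<integral>x. (f x - p x)\<^sup>2 \<partial>torus) < e"
proof -
  define c where "c k x = max (- real k) (min (real k) (f x))" for k x
  have fm: "f \<in> borel_measurable torus" using f by (simp add: square_integrable_def)
  then have cm: "c k \<in> borel_measurable torus" for k unfolding c_def by measurable
  have cb: "\<bar>c k x\<bar> \<le> real k" for k x unfolding c_def by auto
  have "(\<lambda>k. \<integral>x. (f x - c k x)\<^sup>2 \<partial>torus) \<longlonglongrightarrow> (\<integral>x. 0 \<partial>(torus :: (real^'n) measure))"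
  proof (rule integral_dominated_convergence[where w="\<lambda>x. (f x)\<^sup>2"])
    show "(\<lambda>x. 0) \<in> borel_measurable torus" by simp
    show "integrable torus (\<lambda>x. (f x)\<^sup>2)" using f by (simp add: square_integrable_def)
    show "(\<lambda>x. (f x - c k x)\<^sup>2) \<in> borel_measurable torus" for k using fm cm by auto
    show "AE x in torus. (\<lambda>k. (f x - c k x)\<^sup>2) \<longlonglongrightarrow> 0"
    proof (rule AE_I2)
      fix x
      have "\<forall>\<^sub>F k in sequentially. real k \<ge> \<bar>f x\<bar>"
        by (meson eventually_sequentiallyI nat_ceiling_le_eq)
      then have "\<forall>\<^sub>F k in sequentially. 0 = (f x - c k x)\<^sup>2"
        by eventually_elim (auto simp: c_def)
      then show "(\<lambda>k. (f x - c k x)\<^sup>2) \<longlonglongrightarrow> 0"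
        by (rule Lim_transform_eventually[OF tendsto_const])
    qed
    show "AE x in torus. norm ((f x - c k x)\<^sup>2) \<le> (f x)\<^sup>2" for k
    proof (rule AE_I2)
      fix x
      have "\<bar>f x - c k x\<bar> \<le> \<bar>f x\<bar>" unfolding c_def by auto
      then show "norm ((f x - c k x)\<^sup>2) \<le> (f x)\<^sup>2" by (simp add: abs_le_square_iff)
    qed
  qed
  then have "\<forall>\<^sub>F k in sequentially. (\<integral>x. (f x - c k x)\<^sup>2 \<partial>torus) < e / 4"
    using e by (intro order_tendstoD) auto
  then obtain k where k: "(\<integral>x. (f x - c k x)\<^sup>2 \<partial>torus) < e / 4"
    using eventually_happens'[OF sequentially_bot] by blast
  obtain p where p: "trig_poly integer_vectors p" "(\<integral>x. (c k x - p x)\<^sup>2 \<partial>torus) < e / 4"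
    using trig_poly_dense_bounded[OF cm cb, of "e/4" k] e by auto
  have sc: "square_integrable torus (c k)"
    unfolding square_integrable_def
  proof
    have "(c k x)\<^sup>2 \<le> (real k)\<^sup>2" for x using cb[of k x] by (metis abs_ge_zero power2_abs power_mono)
    then show "integrable torus (\<lambda>x. (c k x)\<^sup>2)"
      using cm by (intro bounded_integrable_torus[where B="(real k)\<^sup>2"]) auto
  qed (rule cm)
  have sp: "square_integrable torus p" by (rule continuous_square_integrable[OF continuous_trig_poly[OF p(1)]])
  have "(\<integral>x. (f x - p x)\<^sup>2 \<partial>torus) = (\<integral>x. ((f x - c k x) + (c k x - p x))\<^sup>2 \<partial>torus)"
    by simp
  also have "\<dots> \<le> 2 * (\<integral>x. (f x - c k x)\<^sup>2 \<partial>torus) + 2 * (\<integral>x. (c k x - p x)\<^sup>2 \<partial>torus)"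
    by (intro integral_square_triangle square_integrable_diff f sc sp)
  finally show ?thesis using that p k by simp
qed


section \<open>Partial Fourier sums\<close>

text \<open>Symmetry of the set under negation makes the real \<open>fourier_sum\<close> below an orthogonal projection:
  \<open>m\<close> and \<open>- m\<close> carry the same real waves, and each contributes half of the projection onto them.\<close>

definition frequency_set :: "(real^'n) set \<Rightarrow> bool" where
  "frequency_set F \<longleftrightarrow> finite F \<and> F \<subseteq> integer_vectors \<and> uminus ` F \<subseteq> F"

definition fourier_coeff :: "(real^'n \<Rightarrow> real) \<Rightarrow> real^'n \<Rightarrow> real \<Rightarrow> real" where
  "fourier_coeff f m \<theta> = (\<integral>x. f x * wave m \<theta> x \<partial>torus)"

definition fourier_sum :: "(real^'n) set \<Rightarrow> (real^'n \<Rightarrow> real) \<Rightarrow> real^'n \<Rightarrow> real" where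
  "fourier_sum F f x = (\<Sum>m\<in>F. fourier_coeff f m 0 * wave m 0 x
     + fourier_coeff f m (-(pi/2)) * wave m (-(pi/2)) x)"

lemma wave_phase: "wave m \<theta> x = cos \<theta> * wave m 0 x - sin \<theta> * wave m (-(pi/2)) x"
  by (simp add: wave_def cos_add cos_diff)

lemma fourier_coeff_phase:
  assumes "square_integrable torus f"
  shows "fourier_coeff f m \<theta> = cos \<theta> * fourier_coeff f m 0 - sin \<theta> * fourier_coeff f m (-(pi/2))"
proof -
  have "fourier_coeff f m \<theta> = (\<integral>x. cos \<theta> * (f x * wave m 0 x) - sin \<theta> * (f x * wave m (-(pi/2)) x) \<partial>torus)"
    unfolding fourier_coeff_def by (subst wave_phase) (simp add: algebra_simps)
  also have "\<dots> = cos \<theta> * fourier_coeff f m 0 - sin \<theta> * fourier_coeff f m (-(pi/2))"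
    unfolding fourier_coeff_def
    using square_integrable_mult[OF assms square_integrable_wave] by simp
  finally show ?thesis .
qed

lemma fourier_coeff_minus: "fourier_coeff f (- m) \<theta> = fourier_coeff f m (- \<theta>)"
proof -
  have "wave (- m) \<theta> = wave m (- \<theta>)"
    unfolding wave_def by (rule ext) (metis cos_minus inner_minus_left minus_add_distrib minus_minus mult_minus_right)
  then show ?thesis by (simp add: fourier_coeff_def)
qed

lemma trig_poly_fourier_sum: "trig_poly F (fourier_sum F f)"
  unfolding fourier_sum_def[abs_def]
  by (intro trig_poly_sum trig_poly_add trig_poly_wave)

lemma square_integrable_fourier_sum: "square_integrable torus (fourier_sum F f)"
  by (rule continuous_square_integrable[OF continuous_trig_poly[OF trig_poly_fourier_sum]])

text \<open>Only the summands \<open>m = k\<close> and \<open>m = - k\<close> survive orthogonality, and each gives half of the coefficient.\<close>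

lemma fourier_coeff_fourier_sum:
  assumes F: "frequency_set F" and f: "square_integrable torus f" and k: "k \<in> F"
  shows "fourier_coeff (fourier_sum F f) k \<theta> = fourier_coeff f k \<theta>"
proof -
  let ?a = "\<lambda>m. fourier_coeff f m 0" and ?b = "\<lambda>m. fourier_coeff f m (-(pi/2))"
  have fin: "finite F" and kz: "k \<in> integer_vectors" and mk: "- k \<in> F"
    and Fz: "\<And>m. m \<in> F \<Longrightarrow> m \<in> integer_vectors"
    using F k by (auto simp: frequency_set_def)
  have int: "integrable torus (\<lambda>x. wave m \<alpha> x * wave k \<theta> x)" for m \<alpha>
    by (intro square_integrable_mult square_integrable_wave)
  have "fourier_coeff (fourier_sum F f) k \<theta>
     = (\<integral>x. (\<Sum>m\<in>F. ?a m * (wave m 0 x * wave k \<theta> x) + ?b m * (wave m (-(pi/2)) x * wave k \<theta> x)) \<partial>torus)"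
    unfolding fourier_coeff_def[of "fourier_sum F f"] fourier_sum_def sum_distrib_right
    by (simp add: algebra_simps)
  also have "\<dots> = (\<Sum>m\<in>F. ?a m * (\<integral>x. wave m 0 x * wave k \<theta> x \<partial>torus)
        + ?b m * (\<integral>x. wave m (-(pi/2)) x * wave k \<theta> x \<partial>torus))"
    using int by simp
  also have "\<dots> = (\<Sum>m\<in>F. (if m = - k then ?a m * cos \<theta> / 2 + ?b m * cos (-(pi/2) + \<theta>) / 2 else 0)
       + (if m = k then ?a m * cos (- \<theta>) / 2 + ?b m * cos (-(pi/2) - \<theta>) / 2 else 0))"
  proof (rule sum.cong[OF refl])
    fix m assume "m \<in> F"
    then show "?a m * (\<integral>x. wave m 0 x * wave k \<theta> x \<partial>torus) + ?b m * (\<integral>x. wave m (-(pi/2)) x * wave k \<theta> x \<partial>torus)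
      = (if m = - k then ?a m * cos \<theta> / 2 + ?b m * cos (-(pi/2) + \<theta>) / 2 else 0)
       + (if m = k then ?a m * cos (- \<theta>) / 2 + ?b m * cos (-(pi/2) - \<theta>) / 2 else 0)"
      by (cases "m = - k"; cases "m = k") (simp_all add: integral_wave_mult Fz kz distrib_left)
  qed
  also have "\<dots> = (?a (- k) * cos \<theta> / 2 + ?b (- k) * cos (-(pi/2) + \<theta>) / 2)
       + (?a k * cos (- \<theta>) / 2 + ?b k * cos (-(pi/2) - \<theta>) / 2)"
    using fin mk k by (simp add: sum.distrib)
  also have "?a (- k) = ?a k" by (simp add: fourier_coeff_minus)
  also have "?b (- k) = - ?b k"
    unfolding fourier_coeff_minus using fourier_coeff_phase[OF f, of k "pi/2"] by simp
  also have "cos (-(pi/2) + \<theta>) = sin \<theta>" unfolding cos_add by simp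
  also have "cos (-(pi/2) - \<theta>) = - sin \<theta>" unfolding cos_diff by simp
  finally show ?thesis
    using fourier_coeff_phase[OF f, of k \<theta>] by simp
qed

lemma fourier_sum_orthogonal:
  assumes F: "frequency_set F" and f: "square_integrable torus f" and p: "trig_poly F p"
  shows "(\<integral>x. (f x - fourier_sum F f x) * p x \<partial>torus) = 0"
  using p
proof induction
  case (wave m p c \<theta>)
  let ?r = "\<lambda>x. f x - fourier_sum F f x"
  have r: "square_integrable torus ?r"
    by (intro square_integrable_diff f square_integrable_fourier_sum)
  have p: "square_integrable torus p"
    by (rule continuous_square_integrable[OF continuous_trig_poly[OF wave(2)]])
  have "(\<integral>x. ?r x * (c * wave m \<theta> x + p x) \<partial>torus)
    = (\<integral>x. c * (f x * wave m \<theta> x - fourier_sum F f x * wave m \<theta> x) + ?r x * p x \<partial>torus)"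
    by (simp add: algebra_simps)
  also have "\<dots> = c * (fourier_coeff f m \<theta> - fourier_coeff (fourier_sum F f) m \<theta>) + (\<integral>x. ?r x * p x \<partial>torus)"
    by (subst Bochner_Integration.integral_add)
      (simp_all add: fourier_coeff_def square_integrable_mult f r p square_integrable_wave square_integrable_fourier_sum)
  finally show ?case
    using fourier_coeff_fourier_sum[OF F f wave(1)] wave(3) by simp
qed simp

lemma fourier_sum_best_approximation:
  assumes F: "frequency_set F" and f: "square_integrable torus f" and p: "trig_poly F p"
  shows "(\<integral>x. (f x - fourier_sum F f x)\<^sup>2 \<partial>torus) \<le> (\<integral>x. (f x - p x)\<^sup>2 \<partial>torus)"
proof -
  let ?S = "fourier_sum F f"
  let ?r = "\<lambda>x. f x - ?S x" and ?q = "\<lambda>x. ?S x + (-1) * p x"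
  have "trig_poly F (\<lambda>x. c * p x)" for c
    using p
  proof induction
    case (wave m p d \<theta>)
    then show ?case
      using trig_poly.wave[OF wave(1) wave(3), of "c * d" \<theta>] by (simp add: algebra_simps)
  qed (simp add: trig_poly.zero)
  then have q: "trig_poly F ?q"
    by (intro trig_poly_add trig_poly_fourier_sum)
  have sr: "square_integrable torus ?r" and sq: "square_integrable torus ?q"
    using f continuous_square_integrable[OF continuous_trig_poly[OF q]]
    by (auto intro!: square_integrable_diff square_integrable_fourier_sum)
  have "(\<integral>x. (f x - p x)\<^sup>2 \<partial>torus) = (\<integral>x. (?r x)\<^sup>2 + (?q x)\<^sup>2 + 2 * (?r x * ?q x) \<partial>torus)"
    by (rule Bochner_Integration.integral_cong) (auto simp: power2_eq_square algebra_simps)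
  also have "\<dots> = (\<integral>x. (?r x)\<^sup>2 \<partial>torus) + (\<integral>x. (?q x)\<^sup>2 \<partial>torus) + 2 * (\<integral>x. ?r x * ?q x \<partial>torus)"
    using square_integrable_mult[OF sr sq] sr sq
    by (subst Bochner_Integration.integral_add;
        simp add: square_integrable_def Bochner_Integration.integrable_add del: mult_minus1 minus_add_distrib)+
  also have "(\<integral>x. ?r x * ?q x \<partial>torus) = 0"
    by (rule fourier_sum_orthogonal[OF F f q])
  finally show ?thesis by simp
qed

lemma integral_fourier_sum_square:
  assumes F: "frequency_set F" and f: "square_integrable torus f"
  shows "(\<integral>x. (fourier_sum F f x)\<^sup>2 \<partial>torus)
    = (\<Sum>m\<in>F. (fourier_coeff f m 0)\<^sup>2 + (fourier_coeff f m (-(pi/2)))\<^sup>2)"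
proof -
  let ?S = "fourier_sum F f"
  have i: "integrable torus (\<lambda>x. ?S x * wave m \<theta> x)" for m \<theta>
    by (intro square_integrable_mult square_integrable_wave square_integrable_fourier_sum)
  have "(\<integral>x. (?S x)\<^sup>2 \<partial>torus) = (\<integral>x. (\<Sum>m\<in>F. fourier_coeff f m 0 * (?S x * wave m 0 x)
     + fourier_coeff f m (-(pi/2)) * (?S x * wave m (-(pi/2)) x)) \<partial>torus)"
    unfolding power2_eq_square
    by (subst (2) fourier_sum_def) (simp add: sum_distrib_left algebra_simps)
  also have "\<dots> = (\<Sum>m\<in>F. fourier_coeff f m 0 * fourier_coeff ?S m 0
     + fourier_coeff f m (-(pi/2)) * fourier_coeff ?S m (-(pi/2)))"
    using i by (simp add: fourier_coeff_def[of ?S])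
  also have "\<dots> = (\<Sum>m\<in>F. (fourier_coeff f m 0)\<^sup>2 + (fourier_coeff f m (-(pi/2)))\<^sup>2)"
    by (rule sum.cong) (auto simp: fourier_coeff_fourier_sum[OF F f] power2_eq_square)
  finally show ?thesis .
qed

lemma fourier_sum_Pythagoras:
  assumes F: "frequency_set F" and f: "square_integrable torus f"
  shows "(\<integral>x. (f x)\<^sup>2 \<partial>torus)
    = (\<integral>x. (fourier_sum F f x)\<^sup>2 \<partial>torus) + (\<integral>x. (f x - fourier_sum F f x)\<^sup>2 \<partial>torus)"
proof -
  let ?S = "fourier_sum F f"
  let ?r = "\<lambda>x. f x - ?S x"
  have sS: "square_integrable torus ?S" by (rule square_integrable_fourier_sum)
  have sr: "square_integrable torus ?r" by (intro square_integrable_diff f sS)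
  have "(\<integral>x. (f x)\<^sup>2 \<partial>torus) = (\<integral>x. (?S x)\<^sup>2 + (?r x)\<^sup>2 + 2 * (?r x * ?S x) \<partial>torus)"
    by (rule Bochner_Integration.integral_cong) (auto simp: power2_eq_square algebra_simps)
  also have "\<dots> = (\<integral>x. (?S x)\<^sup>2 \<partial>torus) + (\<integral>x. (?r x)\<^sup>2 \<partial>torus) + 2 * (\<integral>x. ?r x * ?S x \<partial>torus)"
    using square_integrable_mult[OF sr sS] sr sS
    by (subst Bochner_Integration.integral_add;
        simp add: square_integrable_def Bochner_Integration.integrable_add)+
  also have "(\<integral>x. ?r x * ?S x \<partial>torus) = 0"
    by (rule fourier_sum_orthogonal[OF F f trig_poly_fourier_sum])
  finally show ?thesis by simp
qed

text \<open>The partial sums are best approximations, so density of trigonometric polynomials gives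
  convergence. Finitely many functions are handled with one common sequence of frequency sets,
  because a function and the components of its gradient have to be approximated together.\<close>

lemma fourier_sum_approx:
  fixes f :: "'j::finite \<Rightarrow> real^'n \<Rightarrow> real"
  assumes f: "\<And>j. square_integrable torus (f j)"
  shows "\<exists>F :: nat \<Rightarrow> (real^'n) set. (\<forall>n. frequency_set (F n)) \<and>
    (\<forall>j. (\<lambda>n. \<integral>x. (fourier_sum (F n) (f j) x - f j x)\<^sup>2 \<partial>torus) \<longlonglongrightarrow> 0)"
proof -
  have "\<exists>F. frequency_set F \<and> (\<forall>j. (\<integral>x. (f j x - fourier_sum F (f j) x)\<^sup>2 \<partial>torus) < e)" if "e > 0" for e
  proof -
    have "\<exists>p. trig_poly integer_vectors p \<and> (\<integral>x. (f j x - p x)\<^sup>2 \<partial>torus) < e" for j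
      using trig_poly_dense[OF f that] by metis
    then obtain p where p: "\<And>j. trig_poly integer_vectors (p j)" "\<And>j. (\<integral>x. (f j x - p j x)\<^sup>2 \<partial>torus) < e"
      by metis
    obtain F where F: "\<And>j. finite (F j)" "\<And>j. F j \<subseteq> integer_vectors" "\<And>j. trig_poly (F j) (p j)"
      using trig_poly_finite_frequencies[OF p(1)] by metis
    define F' where "F' = (\<Union>j. F j) \<union> uminus ` (\<Union>j. F j)"
    have F': "frequency_set F'"
      unfolding frequency_set_def F'_def using F(1)
      by (auto simp: image_iff intro: subsetD[OF F(2)] integer_vectors_closed(4)[OF subsetD[OF F(2)]])
    have "trig_poly F' (p j)" for j
      by (rule trig_poly_mono[OF F(3)]) (auto simp: F'_def)
    then have "(\<integral>x. (f j x - fourier_sum F' (f j) x)\<^sup>2 \<partial>torus) < e" for j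
      using fourier_sum_best_approximation[OF F' f] p(2) le_less_trans by blast
    then show ?thesis using F' by blast
  qed
  then have "\<exists>F. frequency_set F \<and> (\<forall>j. (\<integral>x. (f j x - fourier_sum F (f j) x)\<^sup>2 \<partial>torus) < inverse (real (Suc n)))" for n
    by (simp del: of_nat_Suc)
  then obtain F where F: "\<And>n. frequency_set (F n)"
     "\<And>n j. (\<integral>x. (f j x - fourier_sum (F n) (f j) x)\<^sup>2 \<partial>torus) < inverse (real (Suc n))"
    by metis
  show ?thesis
  proof (intro exI[of _ F] conjI allI)
    show "frequency_set (F n)" for n by (rule F(1))
    fix j
    show "(\<lambda>n. \<integral>x. (fourier_sum (F n) (f j) x - f j x)\<^sup>2 \<partial>torus) \<longlonglongrightarrow> 0"
    proof (rule Lim_null_comparison[OF _ LIMSEQ_inverse_real_of_nat], rule always_eventually, rule allI)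
      fix n
      show "norm (\<integral>x. (fourier_sum (F n) (f j) x - f j x)\<^sup>2 \<partial>torus) \<le> inverse (real (Suc n))"
        using F(2)[where n=n and j=j] by (simp add: power2_commute less_imp_le)
    qed
  qed
qed

section \<open>Weak gradients\<close>

lemma L2_torus_square_integrable:
  fixes f :: "real^'n \<Rightarrow> real"
  shows "f \<in> L2_torus \<Longrightarrow> square_integrable torus f"
  by (simp add: L2_torus_def square_integrable_def measurable_torusI)

lemma L2_torus_component:
  fixes G :: "real^'n \<Rightarrow> real^'n"
  assumes "G \<in> L2_torus"
  shows "square_integrable torus (\<lambda>x. G x $ i)"
  unfolding square_integrable_def
proof
  have m: "G \<in> borel_measurable torus" and i: "integrable torus (\<lambda>x. (norm (G x))\<^sup>2)"
    using assms by (auto simp: L2_torus_def intro: measurable_torusI)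
  have "(\<lambda>x. G x \<bullet> axis i 1) \<in> borel_measurable torus"
    using m by (intro borel_measurable_inner) auto
  then show *: "(\<lambda>x. G x $ i) \<in> borel_measurable torus" by (simp add: inner_axis)
  show "integrable torus (\<lambda>x. (G x $ i)\<^sup>2)"
  proof (rule Bochner_Integration.integrable_bound[OF i])
    show "(\<lambda>x. (G x $ i)\<^sup>2) \<in> borel_measurable torus" using * by auto
    show "AE x in torus. norm ((G x $ i)\<^sup>2) \<le> norm ((norm (G x))\<^sup>2)"
      by (rule AE_I2) (simp add: component_le_norm_cart abs_le_square_iff[symmetric])
  qed
qed

lemma norm_square_cart: "(norm (x::real^'n))\<^sup>2 = (\<Sum>i\<in>UNIV. (x $ i)\<^sup>2)"
  unfolding power2_norm_eq_inner inner_vec_def by (simp add: power2_eq_square)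

lemma integral_norm_square:
  fixes G :: "real^'n \<Rightarrow> real^'n"
  assumes "G \<in> L2_torus"
  shows "(\<integral>x. (norm (G x))\<^sup>2 \<partial>torus) = (\<Sum>i\<in>UNIV. \<integral>x. (G x $ i)\<^sup>2 \<partial>torus)"
  unfolding norm_square_cart using L2_torus_component[OF assms]
  by (simp add: square_integrable_def)

lemma fourier_coeff_weak_gradient:
  assumes w: "has_weak_gradient w G" and m: "m \<in> integer_vectors"
  shows "fourier_coeff (\<lambda>x. G x $ i) m \<theta> = - (2 * pi * m $ i) * fourier_coeff w m (\<theta> + pi/2)"
proof -
  have "smooth (wave m \<theta>) \<and> periodic (wave m \<theta>)"
    using smooth_wave[of 1 m \<theta>] periodic_wave[OF m] by simp
  then have "(\<integral>x. w x * partial_deriv i (wave m \<theta>) x \<partial>torus) = - (\<integral>x. G x $ i * wave m \<theta> x \<partial>torus)"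
    using w unfolding has_weak_gradient_def by blast
  moreover have "partial_deriv i (wave m \<theta>) = (\<lambda>x. (2 * pi * m $ i) * wave m (\<theta> + pi/2) x)"
    using partial_deriv_wave[of i 1 m \<theta>] by simp
  moreover have "(\<lambda>x. w x * ((2 * pi * m $ i) * wave m (\<theta> + pi/2) x)) = (\<lambda>x. (2 * pi * m $ i) * (w x * wave m (\<theta> + pi/2) x))"
    by (simp add: algebra_simps)
  ultimately show ?thesis unfolding fourier_coeff_def by simp
qed

lemma fourier_sum_has_derivative:
  "(fourier_sum F f has_derivative (\<lambda>h. \<Sum>m\<in>F. fourier_coeff f m 0 * (2 * pi) * (m \<bullet> h) * wave m (0 + pi/2) x
     + fourier_coeff f m (-(pi/2)) * (2 * pi) * (m \<bullet> h) * wave m (-(pi/2) + pi/2) x)) (at x)"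
  unfolding fourier_sum_def[abs_def]
  by (intro has_derivative_sum has_derivative_add wave_has_derivative)

lemma fourier_sum_differentiable: "fourier_sum F f differentiable at x"
  using fourier_sum_has_derivative differentiable_def by blast

text \<open>Testing the weak gradient against waves turns it into multiplication of the Fourier coefficients by
  the frequency, exactly as differentiating a wave does.\<close>

lemma partial_deriv_fourier_sum:
  assumes w: "has_weak_gradient w G" and sw: "square_integrable torus w" and F: "frequency_set F"
  shows "partial_deriv i (fourier_sum F w) = fourier_sum F (\<lambda>x. G x $ i)"
proof
  fix x
  have "partial_deriv i (fourier_sum F w) x = (\<Sum>m\<in>F. fourier_coeff w m 0 * (2 * pi) * m $ i * wave m (0 + pi/2) x
     + fourier_coeff w m (-(pi/2)) * (2 * pi) * m $ i * wave m (-(pi/2) + pi/2) x)"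
    unfolding partial_deriv_def
    by (simp add: frechet_derivative_at[OF fourier_sum_has_derivative, symmetric] inner_axis)
  also have "\<dots> = fourier_sum F (\<lambda>x. G x $ i) x"
    unfolding fourier_sum_def
  proof (rule sum.cong[OF refl])
    fix m assume "m \<in> F"
    then have m: "m \<in> integer_vectors" using F by (auto simp: frequency_set_def)
    show "fourier_coeff w m 0 * (2 * pi) * m $ i * wave m (0 + pi/2) x
        + fourier_coeff w m (-(pi/2)) * (2 * pi) * m $ i * wave m (-(pi/2) + pi/2) x
        = fourier_coeff (\<lambda>x. G x $ i) m 0 * wave m 0 x
          + fourier_coeff (\<lambda>x. G x $ i) m (-(pi/2)) * wave m (-(pi/2)) x"
      unfolding fourier_coeff_weak_gradient[OF w m]
      using fourier_coeff_phase[OF sw, of m "pi/2"] wave_phase[of m "pi/2" x]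
      by (simp add: algebra_simps)
  qed
  finally show "partial_deriv i (fourier_sum F w) x = fourier_sum F (\<lambda>x. G x $ i) x" .
qed

lemma periodic_fourier_sum:
  fixes f :: "real^'n \<Rightarrow> real"
  assumes "frequency_set F"
  shows "periodic (fourier_sum F f)"
  unfolding periodic_def fourier_sum_def
proof (intro allI impI sum.cong refl)
  fix x k m :: "real^'n" assume "\<forall>i. k $ i \<in> \<int>" "m \<in> F"
  then have "wave m \<theta> (x + k) = wave m \<theta> x" for \<theta>
    using assms periodic_wave[of m \<theta>] by (auto simp: frequency_set_def periodic_def)
  then show "fourier_coeff f m 0 * wave m 0 (x + k) + fourier_coeff f m (-(pi/2)) * wave m (-(pi/2)) (x + k)
    = fourier_coeff f m 0 * wave m 0 x + fourier_coeff f m (-(pi/2)) * wave m (-(pi/2)) x" by simp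
qed


lemma smooth_continuous_deriv:
  fixes f :: "real^'n \<Rightarrow> 'b::real_normed_vector"
  assumes "smooth f"
  shows "f differentiable at x" "continuous_on UNIV f" "continuous_on UNIV (partial_deriv i f)"
proof -
  have "C_k (Suc 0) f" "C_k 0 f" using assms unfolding smooth_def by blast+
  then show "f differentiable at x" "continuous_on UNIV f" "continuous_on UNIV (partial_deriv i f)"
    by simp_all
qed

text \<open>All partial Fourier sums of such a function are zero, and they converge to it.\<close>

lemma AE_zero_of_fourier_coeff_zero:
  assumes f: "square_integrable torus f" and z: "\<And>m \<theta>. m \<in> integer_vectors \<Longrightarrow> fourier_coeff f m \<theta> = 0"
  shows "AE x in torus. f x = 0"
proof -
  obtain F :: "nat \<Rightarrow> _" where F: "\<forall>n. frequency_set (F n)"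
      "\<forall>j::unit. (\<lambda>n. \<integral>x. (fourier_sum (F n) f x - f x)\<^sup>2 \<partial>torus) \<longlonglongrightarrow> 0"
    using fourier_sum_approx[of "\<lambda>_::unit. f", OF f] by (elim exE conjE)
  have "fourier_sum (F n) f x = 0" for n x
    unfolding fourier_sum_def using F(1)[rule_format, of n] z by (intro sum.neutral) (auto simp: frequency_set_def)
  then have "(\<integral>x. (f x)\<^sup>2 \<partial>torus) = 0"
    using F(2) LIMSEQ_unique[OF tendsto_const] by simp
  then show ?thesis
    using f integral_nonneg_eq_0_iff_AE[of torus "\<lambda>x. (f x)\<^sup>2"] by (simp add: square_integrable_def)
qed

lemma weak_gradient_unique:
  fixes G G' :: "real^'n \<Rightarrow> real^'n"
  assumes w: "has_weak_gradient w G" "has_weak_gradient w G'" and G: "G \<in> L2_torus" "G' \<in> L2_torus"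
  shows "AE x in torus. G x = G' x"
proof -
  have "AE x in torus. \<forall>i\<in>UNIV. G x $ i - G' x $ i = 0"
  proof (rule AE_finite_allI)
    fix i :: 'n
    note s = L2_torus_component[OF G(1), of i] L2_torus_component[OF G(2), of i]
    show "AE x in torus. G x $ i - G' x $ i = 0"
    proof (rule AE_zero_of_fourier_coeff_zero)
      show "square_integrable torus (\<lambda>x. G x $ i - G' x $ i)" by (intro square_integrable_diff s)
      fix m \<theta> assume m: "m \<in> (integer_vectors :: (real^'n) set)"
      have "fourier_coeff (\<lambda>x. G x $ i - G' x $ i) m \<theta>
         = fourier_coeff (\<lambda>x. G x $ i) m \<theta> - fourier_coeff (\<lambda>x. G' x $ i) m \<theta>"
        unfolding fourier_coeff_def left_diff_distrib
        using s by (simp add: square_integrable_mult square_integrable_wave)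
      then show "fourier_coeff (\<lambda>x. G x $ i - G' x $ i) m \<theta> = 0"
        using fourier_coeff_weak_gradient[OF w(1) m] fourier_coeff_weak_gradient[OF w(2) m] by simp
    qed
  qed simp
  then show ?thesis by eventually_elim (simp add: vec_eq_iff)
qed

lemma has_weak_gradient_diff:
  fixes u v :: "real^'n \<Rightarrow> real"
  assumes "u \<in> L2_torus" "v \<in> L2_torus" "G \<in> L2_torus" "G' \<in> L2_torus"
    "has_weak_gradient u G" "has_weak_gradient v G'"
  shows "has_weak_gradient (\<lambda>x. u x - v x) (\<lambda>x. G x - G' x)"
  unfolding has_weak_gradient_def
proof (intro allI impI)
  fix \<phi> :: "real^'n \<Rightarrow> real" and i assume p: "smooth \<phi> \<and> periodic \<phi>"
  note c = smooth_continuous_deriv[OF conjunct1[OF p]]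
  have s: "square_integrable torus \<phi>" "square_integrable torus (partial_deriv i \<phi>)"
    using c by (auto intro: continuous_square_integrable)
  have "(\<integral>x. (u x - v x) * partial_deriv i \<phi> x \<partial>torus)
      = (\<integral>x. u x * partial_deriv i \<phi> x \<partial>torus) - (\<integral>x. v x * partial_deriv i \<phi> x \<partial>torus)"
    unfolding left_diff_distrib using assms s
    by (simp add: square_integrable_mult L2_torus_square_integrable)
  also have "\<dots> = - (\<integral>x. G x $ i * \<phi> x \<partial>torus) + (\<integral>x. G' x $ i * \<phi> x \<partial>torus)"
    using assms(5,6) p unfolding has_weak_gradient_def by auto
  also have "\<dots> = - (\<integral>x. (G x - G' x) $ i * \<phi> x \<partial>torus)"
    using assms s by (simp add: left_diff_distrib square_integrable_mult L2_torus_component)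
  finally show "(\<integral>x. (u x - v x) * partial_deriv i \<phi> x \<partial>torus) = - (\<integral>x. (G x - G' x) $ i * \<phi> x \<partial>torus)" .
qed

lemma L2_torus_diff:
  fixes f g :: "real^'n \<Rightarrow> 'b::euclidean_space"
  assumes "f \<in> L2_torus" "g \<in> L2_torus"
  shows "(\<lambda>x. f x - g x) \<in> L2_torus"
proof -
  have m: "f \<in> borel_measurable lebesgue" "g \<in> borel_measurable lebesgue"
    using assms by (auto simp: L2_torus_def)
  then have md: "(\<lambda>x. f x - g x) \<in> borel_measurable lebesgue" by auto
  have "integrable torus (\<lambda>x. (norm (f x - g x))\<^sup>2)"
  proof (rule Bochner_Integration.integrable_bound)
    show "integrable torus (\<lambda>x. 2 * (norm (f x))\<^sup>2 + 2 * (norm (g x))\<^sup>2)"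
      using assms by (simp add: L2_torus_def)
    show "(\<lambda>x. (norm (f x - g x))\<^sup>2) \<in> borel_measurable torus"
      using measurable_torusI[OF md] by auto
    show "AE x in torus. norm ((norm (f x - g x))\<^sup>2) \<le> norm (2 * (norm (f x))\<^sup>2 + 2 * (norm (g x))\<^sup>2)"
    proof (rule AE_I2)
      fix x
      have "(norm (f x - g x))\<^sup>2 \<le> (norm (f x) + norm (g x))\<^sup>2"
        by (intro power_mono norm_triangle_ineq4) auto
      also have "\<dots> \<le> 2 * (norm (f x))\<^sup>2 + 2 * (norm (g x))\<^sup>2"
        using sum_squares_bound[of "norm (f x)" "norm (g x)"] by (simp add: power2_sum)
      finally show "norm ((norm (f x - g x))\<^sup>2) \<le> norm (2 * (norm (f x))\<^sup>2 + 2 * (norm (g x))\<^sup>2)"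
        by simp
    qed
  qed
  then show ?thesis using assms md by (auto simp: L2_torus_def periodic_def)
qed

lemma L2_torus_norm_square_integrable:
  fixes f :: "real^'n \<Rightarrow> 'b::euclidean_space"
  assumes "f \<in> L2_torus"
  shows "square_integrable torus (\<lambda>x. norm (f x))"
  unfolding square_integrable_def
proof
  have "f \<in> borel_measurable torus" using assms by (auto simp: L2_torus_def intro: measurable_torusI)
  then show "(\<lambda>x. norm (f x)) \<in> borel_measurable torus" by measurable
  show "integrable torus (\<lambda>x. (norm (f x))\<^sup>2)" using assms by (simp add: L2_torus_def)
qed

lemma wgrad:
  assumes "u \<in> H1_torus"
  shows "wgrad u \<in> L2_torus" "has_weak_gradient u (wgrad u)"
proof -
  have "\<exists>G. G \<in> L2_torus \<and> has_weak_gradient u G" using assms by (auto simp: H1_torus_def)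
  from someI_ex[OF this] have "wgrad u \<in> L2_torus \<and> has_weak_gradient u (wgrad u)"
    unfolding wgrad_def .
  then show "wgrad u \<in> L2_torus" "has_weak_gradient u (wgrad u)" by auto
qed

lemma H1_perD:
  assumes "u \<in> H1_per"
  shows "u \<in> H1_torus" "u \<in> L2_torus" "wgrad u \<in> L2_torus" "has_weak_gradient u (wgrad u)"
    "(\<integral>x. u x \<partial>torus) = 0"
  using assms wgrad by (auto simp: H1_per_def H1_torus_def)

lemma H1_perI:
  assumes "u \<in> L2_torus" "G \<in> L2_torus" "has_weak_gradient u G" "(\<integral>x. u x \<partial>torus) = 0"
  shows "u \<in> H1_per" "AE x in torus. wgrad u x = G x"
proof -
  show u: "u \<in> H1_per" using assms by (auto simp: H1_per_def H1_torus_def)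
  show "AE x in torus. wgrad u x = G x"
    using weak_gradient_unique[OF H1_perD(4)[OF u] assms(3) H1_perD(3)[OF u] assms(2)] .
qed

lemma H1_per_diff:
  assumes u: "u \<in> H1_per" and v: "v \<in> H1_per"
  shows "(\<lambda>x. u x - v x) \<in> H1_per" "AE x in torus. wgrad (\<lambda>x. u x - v x) x = wgrad u x - wgrad v x"
proof -
  have m: "(\<integral>x. u x - v x \<partial>torus) = 0"
    using H1_perD[OF u] H1_perD[OF v]
    by (simp add: square_integrable_integrable L2_torus_square_integrable)
  note U = H1_perD[OF u] and W = H1_perD[OF v]
  note I = H1_perI[OF L2_torus_diff[OF U(2) W(2)] L2_torus_diff[OF U(3) W(3)]
      has_weak_gradient_diff[OF U(2) W(2) U(3) W(3) U(4) W(4)] m]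
  show "(\<lambda>x. u x - v x) \<in> H1_per" by (rule I(1))
  show "AE x in torus. wgrad (\<lambda>x. u x - v x) x = wgrad u x - wgrad v x" by (rule I(2))
qed

lemma has_weak_gradient_limit:
  fixes u :: "nat \<Rightarrow> real^'n \<Rightarrow> real"
  assumes u: "\<And>k. u k \<in> L2_torus" "v \<in> L2_torus" "(\<lambda>k. \<integral>x. (u k x - v x)\<^sup>2 \<partial>torus) \<longlonglongrightarrow> 0"
    and G: "\<And>k. G k \<in> L2_torus" "g \<in> L2_torus" "(\<lambda>k. \<integral>x. (norm (G k x - g x))\<^sup>2 \<partial>torus) \<longlonglongrightarrow> 0"
    and w: "\<And>k. has_weak_gradient (u k) (G k)"
  shows "has_weak_gradient v g"
  unfolding has_weak_gradient_def
proof (intro allI impI)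
  fix \<phi> :: "real^'n \<Rightarrow> real" and i assume p: "smooth \<phi> \<and> periodic \<phi>"
  note c = smooth_continuous_deriv[OF conjunct1[OF p]]
  have s: "square_integrable torus \<phi>" "square_integrable torus (partial_deriv i \<phi>)"
    using c by (auto intro: continuous_square_integrable)
  have gi: "(\<lambda>k. \<integral>x. (G k x $ i - g x $ i)\<^sup>2 \<partial>torus) \<longlonglongrightarrow> 0"
  proof (rule Lim_null_comparison[OF _ G(3)], rule always_eventually, rule allI)
    fix k
    have d: "(\<lambda>x. G k x - g x) \<in> L2_torus" by (intro L2_torus_diff G)
    have "(\<integral>x. ((G k x - g x) $ i)\<^sup>2 \<partial>torus) \<le> (\<integral>x. (norm (G k x - g x))\<^sup>2 \<partial>torus)"
    proof (rule integral_mono)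
      show "integrable torus (\<lambda>x. ((G k x - g x) $ i)\<^sup>2)"
        using L2_torus_component[OF d] by (simp only: square_integrable_def)
      show "integrable torus (\<lambda>x. (norm (G k x - g x))\<^sup>2)"
        using d by (simp add: L2_torus_def)
      show "((G k x - g x) $ i)\<^sup>2 \<le> (norm (G k x - g x))\<^sup>2" for x
        unfolding norm_square_cart by (rule member_le_sum) auto
    qed
    then show "norm (\<integral>x. (G k x $ i - g x $ i)\<^sup>2 \<partial>torus) \<le> (\<integral>x. (norm (G k x - g x))\<^sup>2 \<partial>torus)"
      by simp
  qed
  have "(\<lambda>k. \<integral>x. u k x * partial_deriv i \<phi> x \<partial>torus) \<longlonglongrightarrow> (\<integral>x. v x * partial_deriv i \<phi> x \<partial>torus)"
    by (rule L2_tendsto_inner) (use u s in \<open>auto intro: L2_torus_square_integrable\<close>)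
  moreover have "(\<lambda>k. \<integral>x. G k x $ i * \<phi> x \<partial>torus) \<longlonglongrightarrow> (\<integral>x. g x $ i * \<phi> x \<partial>torus)"
    by (rule L2_tendsto_inner) (use G gi s in \<open>auto intro: L2_torus_component\<close>)
  moreover have "(\<integral>x. u k x * partial_deriv i \<phi> x \<partial>torus) = - (\<integral>x. G k x $ i * \<phi> x \<partial>torus)" for k
    using w[of k] p unfolding has_weak_gradient_def by blast
  ultimately show "(\<integral>x. v x * partial_deriv i \<phi> x \<partial>torus) = - (\<integral>x. g x $ i * \<phi> x \<partial>torus)"
    using LIMSEQ_unique[OF _ tendsto_minus] by simp
qed

section \<open>Poincare inequality and the transport term\<close>

lemma norm_integer_vector_ge_1:
  assumes "m \<in> integer_vectors" "m \<noteq> 0"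
  shows "1 \<le> (\<Sum>i\<in>UNIV. (m $ i)\<^sup>2)"
proof -
  obtain i where i: "m $ i \<noteq> 0" using assms by (auto simp: vec_eq_iff)
  have "m $ i \<in> \<int>" using assms by (simp add: integer_vectors_def)
  then have "1 \<le> \<bar>m $ i\<bar>" using i by (rule Ints_nonzero_abs_ge1)
  then have "1 \<le> (m $ i)\<^sup>2" using power_mono[of 1 "\<bar>m $ i\<bar>" 2] by simp
  also have "\<dots> \<le> (\<Sum>i\<in>UNIV. (m $ i)\<^sup>2)" by (rule member_le_sum) auto
  finally show ?thesis .
qed

text \<open>Smooth functions are dense in \<open>H\<^sup>1\<close>: together with \<open>partial_deriv_fourier_sum\<close> this says that
  the Fourier sums of \<open>w\<close> and their gradients converge.\<close>

lemma H1_fourier_approx: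
  fixes w :: "real^'n \<Rightarrow> real" and G :: "real^'n \<Rightarrow> real^'n"
  assumes w: "w \<in> L2_torus" and G: "G \<in> L2_torus"
  shows "\<exists>F :: nat \<Rightarrow> (real^'n) set. (\<forall>n. frequency_set (F n)) \<and>
    (\<lambda>n. \<integral>x. (fourier_sum (F n) w x - w x)\<^sup>2 \<partial>torus) \<longlonglongrightarrow> 0 \<and>
    (\<forall>i. (\<lambda>n. \<integral>x. (fourier_sum (F n) (\<lambda>x. G x $ i) x - G x $ i)\<^sup>2 \<partial>torus) \<longlonglongrightarrow> 0)"
proof -
  \<comment> \<open>One finite family holds the function (index None) and the components of its gradient.\<close>
  define f where "f j = (case j of None \<Rightarrow> w | Some i \<Rightarrow> (\<lambda>x. G x $ i))" for j
  have "square_integrable torus (f j)" for j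
    using L2_torus_square_integrable[OF w] L2_torus_component[OF G] by (simp add: f_def split: option.split)
  from fourier_sum_approx[of f, OF this]
  obtain F :: "nat \<Rightarrow> _" where F: "\<forall>n. frequency_set (F n)"
    "\<forall>j. (\<lambda>n. \<integral>x. (fourier_sum (F n) (f j) x - f j x)\<^sup>2 \<partial>torus) \<longlonglongrightarrow> 0"
    by (elim exE conjE)
  show ?thesis
  proof (intro exI[of _ F] conjI allI)
    show "frequency_set (F n)" for n using F(1) by blast
    show "(\<lambda>n. \<integral>x. (fourier_sum (F n) w x - w x)\<^sup>2 \<partial>torus) \<longlonglongrightarrow> 0"
      using F(2)[rule_format, of None] by (simp add: f_def)
    show "(\<lambda>n. \<integral>x. (fourier_sum (F n) (\<lambda>x. G x $ i) x - G x $ i)\<^sup>2 \<partial>torus) \<longlonglongrightarrow> 0" for i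
      using F(2)[rule_format, of "Some i"] by (simp add: f_def)
  qed
qed

text \<open>By Parseval both sides are sums over frequencies \<open>m\<close>, with weights \<open>(2 pi)\<^sup>2\<close> and \<open>(2 pi |m|)\<^sup>2\<close>. A nonzero
  integer vector has \<open>|m| \<ge> 1\<close>, and the coefficient at \<open>m = 0\<close> is the mean.\<close>

lemma Poincare:
  fixes w :: "real^'n \<Rightarrow> real" and G :: "real^'n \<Rightarrow> real^'n"
  assumes w: "w \<in> L2_torus" and G: "G \<in> L2_torus" and wG: "has_weak_gradient w G"
    and mean: "(\<integral>x. w x \<partial>torus) = 0"
  shows "(2 * pi)\<^sup>2 * (\<integral>x. (w x)\<^sup>2 \<partial>torus) \<le> (\<integral>x. (norm (G x))\<^sup>2 \<partial>torus)"
proof -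
  have sw: "square_integrable torus w" by (rule L2_torus_square_integrable[OF w])
  have sG: "square_integrable torus (\<lambda>x. G x $ i)" for i by (rule L2_torus_component[OF G])
  have le: "(2 * pi)\<^sup>2 * (\<integral>x. (fourier_sum F w x)\<^sup>2 \<partial>torus) \<le> (\<integral>x. (norm (G x))\<^sup>2 \<partial>torus)"
    if F: "frequency_set F" for F
  proof -
    let ?e = "\<lambda>m. (fourier_coeff w m 0)\<^sup>2 + (fourier_coeff w m (-(pi/2)))\<^sup>2"
    have Fz: "m \<in> integer_vectors" if "m \<in> F" for m using F that by (auto simp: frequency_set_def)
    have b: "(fourier_coeff (\<lambda>x. G x $ i) m 0)\<^sup>2 + (fourier_coeff (\<lambda>x. G x $ i) m (-(pi/2)))\<^sup>2
        = (2 * pi)\<^sup>2 * (m $ i)\<^sup>2 * ?e m" if "m \<in> F" for m i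
    proof -
      have "fourier_coeff w m (pi/2) = - fourier_coeff w m (-(pi/2))"
        using fourier_coeff_phase[OF sw, of m "pi/2"] by simp
      then show ?thesis
        unfolding fourier_coeff_weak_gradient[OF wG Fz[OF that]]
        by (simp add: power_mult_distrib algebra_simps)
    qed
    have "?e m \<le> (\<Sum>i\<in>UNIV. (m $ i)\<^sup>2) * ?e m" if "m \<in> F" for m
    proof (cases "m = 0")
      case True
      then show ?thesis using mean by (simp add: fourier_coeff_def wave_def)
    next
      case False
      then show ?thesis
        using mult_right_mono[OF norm_integer_vector_ge_1[OF Fz[OF that] False], of "?e m"] by simp
    qed
    then have "(2 * pi)\<^sup>2 * (\<Sum>m\<in>F. ?e m) \<le> (2 * pi)\<^sup>2 * (\<Sum>m\<in>F. (\<Sum>i\<in>UNIV. (m $ i)\<^sup>2) * ?e m)"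
      by (intro mult_left_mono sum_mono) auto
    also have "\<dots> = (\<Sum>m\<in>F. \<Sum>i\<in>UNIV. (2 * pi)\<^sup>2 * (m $ i)\<^sup>2 * ?e m)"
      by (simp only: sum_distrib_left sum_distrib_right mult.assoc)
    also have "\<dots> = (\<Sum>i\<in>UNIV. \<Sum>m\<in>F. (2 * pi)\<^sup>2 * (m $ i)\<^sup>2 * ?e m)"
      by (rule sum.swap)
    also have "\<dots> = (\<Sum>i\<in>UNIV. \<integral>x. (fourier_sum F (\<lambda>x. G x $ i) x)\<^sup>2 \<partial>torus)"
      using b by (simp add: integral_fourier_sum_square[OF F sG])
    also have "\<dots> \<le> (\<Sum>i\<in>UNIV. \<integral>x. (G x $ i)\<^sup>2 \<partial>torus)"
      using fourier_sum_Pythagoras[OF F sG] by (intro sum_mono) simp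
    also have "\<dots> = (\<integral>x. (norm (G x))\<^sup>2 \<partial>torus)"
      by (rule integral_norm_square[OF G, symmetric])
    finally show ?thesis by (simp add: integral_fourier_sum_square[OF F sw])
  qed
  obtain F where F': "\<forall>n::nat. frequency_set (F n)"
    "(\<lambda>n. \<integral>x. (fourier_sum (F n) w x - w x)\<^sup>2 \<partial>torus) \<longlonglongrightarrow> 0"
    "\<forall>i. (\<lambda>n. \<integral>x. (fourier_sum (F n) (\<lambda>x. G x $ i) x - G x $ i)\<^sup>2 \<partial>torus) \<longlonglongrightarrow> 0"
    using H1_fourier_approx[OF w G] by (elim exE conjE)
  note F = F'(1)[rule_format] F'(2) F'(3)[rule_format]
  have "(\<lambda>n. \<integral>x. fourier_sum (F n) w x * fourier_sum (F n) w x \<partial>torus) \<longlonglongrightarrow> (\<integral>x. w x * w x \<partial>torus)"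
    by (rule L2_tendsto_inner) (use F sw square_integrable_fourier_sum in auto)
  then have "(\<lambda>n. (2 * pi)\<^sup>2 * (\<integral>x. (fourier_sum (F n) w x)\<^sup>2 \<partial>torus)) \<longlonglongrightarrow> (2 * pi)\<^sup>2 * (\<integral>x. (w x)\<^sup>2 \<partial>torus)"
    by (intro tendsto_mult_left) (simp add: power2_eq_square)
  then show ?thesis
    by (rule LIMSEQ_le_const2) (use le F in auto)
qed

text \<open>The divergence of \<open>S\<^sup>2 V\<close> is \<open>2 (V \<bullet> DS) S\<close> when \<open>V\<close> is divergence free, and its integral is zero.\<close>

lemma transport_term_smooth:
  fixes V :: "real^'n \<Rightarrow> real^'n" and S :: "real^'n \<Rightarrow> real"
  assumes V: "smooth V" "periodic V" "\<And>x. divergence V x = 0"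
    and S: "\<And>x. S differentiable at x" "\<And>i. continuous_on UNIV (partial_deriv i S)" "periodic S"
  shows "(\<integral>x. (\<Sum>i\<in>UNIV. V x $ i * partial_deriv i S x) * S x \<partial>torus) = 0"
proof -
  note Vd = smooth_continuous_deriv[OF V(1)]
  have cS: "continuous_on UNIV S"
    using S(1) by (simp add: continuous_at_imp_continuous_on differentiable_imp_continuous_within)
  define f where "f i x = V x $ i * (S x)\<^sup>2" for i x
  have der: "(f i has_derivative (\<lambda>h. frechet_derivative V (at x) h $ i * (S x)\<^sup>2
       + V x $ i * (2 * S x * frechet_derivative S (at x) h))) (at x)" for i x
  proof -
    have dV: "(V has_derivative frechet_derivative V (at x)) (at x)" using Vd(1) frechet_derivative_works by blast
    have dS: "(S has_derivative frechet_derivative S (at x)) (at x)" using S(1) frechet_derivative_works by blast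
    have "((\<lambda>x. V x $ i) has_derivative (\<lambda>h. frechet_derivative V (at x) h $ i)) (at x)"
      using bounded_linear.has_derivative[OF bounded_linear_vec_nth dV] .
    from has_derivative_mult[OF this has_derivative_power[OF dS, of 2]]
    show ?thesis unfolding f_def[abs_def] by (simp add: algebra_simps)
  qed
  have pd: "partial_deriv i (f i) x = partial_deriv i V x $ i * (S x)\<^sup>2 + 2 * (V x $ i * partial_deriv i S x * S x)" for i x
    unfolding partial_deriv_def by (simp add: frechet_derivative_at[OF der, symmetric])
  have ci: "continuous_on UNIV (\<lambda>x. partial_deriv i (f i) x)" for i
    unfolding pd by (intro continuous_intros cS S(2) Vd)
  have z: "(\<integral>x. partial_deriv i (f i) x \<partial>torus) = 0" for i
  proof (rule integral_partial_deriv_eq_0)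
    show "f i differentiable at x" for x using der differentiable_def by blast
    show "continuous_on UNIV (partial_deriv i (f i))" by (rule ci)
    show "periodic (f i)" using V(2) S(3) by (auto simp: periodic_def f_def)
  qed
  have "0 = (\<Sum>i\<in>UNIV. \<integral>x. partial_deriv i (f i) x \<partial>torus)" using z by simp
  also have "\<dots> = (\<integral>x. (\<Sum>i\<in>UNIV. partial_deriv i (f i) x) \<partial>torus)"
    using continuous_integrable_torus[OF ci] by (intro Bochner_Integration.integral_sum[symmetric])
  also have "\<dots> = (\<integral>x. 2 * ((\<Sum>i\<in>UNIV. V x $ i * partial_deriv i S x) * S x) \<partial>torus)"
  proof (rule Bochner_Integration.integral_cong[OF refl])
    fix x
    have "(\<Sum>i\<in>UNIV. partial_deriv i (f i) x) = divergence V x * (S x)\<^sup>2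
       + 2 * ((\<Sum>i\<in>UNIV. V x $ i * partial_deriv i S x) * S x)"
      unfolding pd divergence_def by (simp add: sum.distrib sum_distrib_right sum_distrib_left)
    then show "(\<Sum>i\<in>UNIV. partial_deriv i (f i) x) = 2 * ((\<Sum>i\<in>UNIV. V x $ i * partial_deriv i S x) * S x)"
      using V(3) by simp
  qed
  finally show ?thesis by simp
qed

text \<open>Both \<open>w\<close> and \<open>V \<bullet> G\<close> are \<open>L\<^sup>2\<close> limits of the corresponding expressions in the Fourier sums of \<open>w\<close>, to which
  \<open>transport_term_smooth\<close> applies.\<close>

lemma transport_term_eq_0:
  fixes V :: "real^'n \<Rightarrow> real^'n" and w :: "real^'n \<Rightarrow> real"
  assumes V: "smooth V" "periodic V" "\<And>x. divergence V x = 0"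
    and w: "w \<in> L2_torus" and G: "G \<in> L2_torus" and wG: "has_weak_gradient w G"
  shows "(\<integral>x. (V x \<bullet> G x) * w x \<partial>torus) = 0"
proof -
  have sw: "square_integrable torus w" by (rule L2_torus_square_integrable[OF w])
  have sG: "square_integrable torus (\<lambda>x. G x $ i)" for i by (rule L2_torus_component[OF G])
  note Vd = smooth_continuous_deriv[OF V(1)]
  obtain B where B: "\<And>x. x \<in> cbox 0 1 \<Longrightarrow> norm (V x) \<le> B"
    using continuous_bounded_on_cube[OF Vd(2)] by blast
  have VB: "\<bar>V x $ i\<bar> \<le> B" if "x \<in> space torus" for x i
    using B[of x] that component_le_norm_cart[of "V x" i] by simp
  have cV: "continuous_on UNIV (\<lambda>x. V x $ i)" for i by (intro continuous_intros Vd)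
  have mV: "(\<lambda>x. V x $ i) \<in> borel_measurable torus" for i
    by (rule continuous_measurable_torus[OF cV])
  have sV: "square_integrable torus (\<lambda>x. V x $ i * f x)" if "square_integrable torus f" for f i
    using square_integrable_bounded_mult[OF that mV VB] .
  obtain F where F': "\<forall>n::nat. frequency_set (F n)"
    "(\<lambda>n. \<integral>x. (fourier_sum (F n) w x - w x)\<^sup>2 \<partial>torus) \<longlonglongrightarrow> 0"
    "\<forall>i. (\<lambda>n. \<integral>x. (fourier_sum (F n) (\<lambda>x. G x $ i) x - G x $ i)\<^sup>2 \<partial>torus) \<longlonglongrightarrow> 0"
    using H1_fourier_approx[OF w G] by (elim exE conjE)
  note F = F'(1)[rule_format] F'(2) F'(3)[rule_format]
  let ?S = "\<lambda>n. fourier_sum (F n) w" and ?T = "\<lambda>n i. fourier_sum (F n) (\<lambda>x. G x $ i)"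
  have lim: "(\<lambda>n. \<integral>x. (V x $ i * ?T n i x) * ?S n x \<partial>torus) \<longlonglongrightarrow> (\<integral>x. (V x $ i * G x $ i) * w x \<partial>torus)" for i
  proof (rule L2_tendsto_inner)
    show "(\<lambda>n. \<integral>x. (V x $ i * ?T n i x - V x $ i * G x $ i)\<^sup>2 \<partial>torus) \<longlonglongrightarrow> 0"
    proof (rule Lim_null_comparison)
      show "(\<lambda>n. B\<^sup>2 * (\<integral>x. (?T n i x - G x $ i)\<^sup>2 \<partial>torus)) \<longlonglongrightarrow> 0"
        using tendsto_mult_left[OF F(3)[of i], of "B\<^sup>2"] by simp
      show "\<forall>\<^sub>F n in sequentially. norm (\<integral>x. (V x $ i * ?T n i x - V x $ i * G x $ i)\<^sup>2 \<partial>torus)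
           \<le> B\<^sup>2 * (\<integral>x. (?T n i x - G x $ i)\<^sup>2 \<partial>torus)"
      proof (rule always_eventually, rule allI)
        fix n
        have d: "square_integrable torus (\<lambda>x. ?T n i x - G x $ i)"
          by (intro square_integrable_diff square_integrable_fourier_sum sG)
        have "(\<integral>x. (V x $ i * (?T n i x - G x $ i))\<^sup>2 \<partial>torus) \<le> (\<integral>x. B\<^sup>2 * (?T n i x - G x $ i)\<^sup>2 \<partial>torus)"
        proof (rule integral_mono)
          show "integrable torus (\<lambda>x. (V x $ i * (?T n i x - G x $ i))\<^sup>2)"
            using sV[OF d] by (simp add: square_integrable_def)
          show "integrable torus (\<lambda>x. B\<^sup>2 * (?T n i x - G x $ i)\<^sup>2)"
            using d by (simp add: square_integrable_def)
          fix x assume "x \<in> space (torus :: (real^'n) measure)"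
          then have "(V x $ i)\<^sup>2 \<le> B\<^sup>2" using VB[of x i] power_mono[of "\<bar>V x $ i\<bar>" B 2] by simp
          then show "(V x $ i * (?T n i x - G x $ i))\<^sup>2 \<le> B\<^sup>2 * (?T n i x - G x $ i)\<^sup>2"
            unfolding power_mult_distrib by (rule mult_right_mono) simp
        qed
        then show "norm (\<integral>x. (V x $ i * ?T n i x - V x $ i * G x $ i)\<^sup>2 \<partial>torus)
           \<le> B\<^sup>2 * (\<integral>x. (?T n i x - G x $ i)\<^sup>2 \<partial>torus)"
          by (simp add: right_diff_distrib)
      qed
    qed
  qed (use F(2) sw in \<open>auto intro: sV sG square_integrable_fourier_sum\<close>)
  have "(\<lambda>n. \<Sum>i\<in>UNIV. \<integral>x. (V x $ i * ?T n i x) * ?S n x \<partial>torus)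
      \<longlonglongrightarrow> (\<Sum>i\<in>UNIV. \<integral>x. (V x $ i * G x $ i) * w x \<partial>torus)"
    by (intro tendsto_sum lim)
  also have "(\<lambda>n. \<Sum>i\<in>UNIV. \<integral>x. (V x $ i * ?T n i x) * ?S n x \<partial>torus) = (\<lambda>n. 0)"
  proof
    fix n
    have "(\<Sum>i\<in>UNIV. \<integral>x. (V x $ i * ?T n i x) * ?S n x \<partial>torus)
       = (\<integral>x. (\<Sum>i\<in>UNIV. (V x $ i * ?T n i x) * ?S n x) \<partial>torus)"
      by (rule Bochner_Integration.integral_sum[symmetric])
        (intro square_integrable_mult sV square_integrable_fourier_sum)
    also have "\<dots> = (\<integral>x. (\<Sum>i\<in>UNIV. V x $ i * partial_deriv i (?S n) x) * ?S n x \<partial>torus)"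
      unfolding partial_deriv_fourier_sum[OF wG sw F(1)] sum_distrib_right ..
    also have "\<dots> = 0"
    proof (rule transport_term_smooth[OF V])
      show "continuous_on UNIV (partial_deriv i (?S n))" for i
        unfolding partial_deriv_fourier_sum[OF wG sw F(1)]
        by (rule continuous_trig_poly[OF trig_poly_fourier_sum])
    qed (use F(1) in \<open>auto intro: fourier_sum_differentiable periodic_fourier_sum\<close>)
    finally show "(\<Sum>i\<in>UNIV. \<integral>x. (V x $ i * ?T n i x) * ?S n x \<partial>torus) = 0" .
  qed
  finally have "(\<Sum>i\<in>UNIV. \<integral>x. (V x $ i * G x $ i) * w x \<partial>torus) = 0"
    using LIMSEQ_unique tendsto_const by blast
  moreover have "(\<Sum>i\<in>UNIV. \<integral>x. (V x $ i * G x $ i) * w x \<partial>torus)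
       = (\<integral>x. (\<Sum>i\<in>UNIV. (V x $ i * G x $ i) * w x) \<partial>torus)"
    by (rule Bochner_Integration.integral_sum[symmetric]) (intro square_integrable_mult sV sG sw)
  moreover have "(\<lambda>x. \<Sum>i\<in>UNIV. (V x $ i * G x $ i) * w x) = (\<lambda>x. (V x \<bullet> G x) * w x)"
    unfolding inner_vec_def by (simp add: sum_distrib_right)
  ultimately show ?thesis by simp
qed


section \<open>Completeness\<close>

text \<open>Cauchy-Schwarz applied to the telescoping sum with weights \<open>2\<^sup>j\<close>. The weights lie strictly between
  \<open>1\<close> and the decay factor \<open>4\<^sup>j\<close> of the squared increments in \<open>L2_torus_complete\<close>, so that the
  weighted sum stays integrable while the tail of the inverse weights tends to zero.\<close>

lemma norm_diff_square_le_weighted_sum: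
  fixes f :: "nat \<Rightarrow> 'b::real_normed_vector"
  assumes "summable (\<lambda>j. 2 ^ j * (norm (f (Suc j) - f j))\<^sup>2)" "k \<le> n"
  shows "(norm (f n - f k))\<^sup>2 \<le> 2 / 2 ^ k * (\<Sum>j. 2 ^ j * (norm (f (Suc j) - f j))\<^sup>2)"
proof -
  let ?g = "\<lambda>j. norm (f (Suc j) - f j)"
  have "norm (f n - f k) = norm (\<Sum>j=k..<n. f (Suc j) - f j)"
    using sum_Suc_diff'[OF assms(2), of f] by simp
  also have "\<dots> \<le> (\<Sum>j=k..<n. ?g j)" by (rule norm_sum)
  finally have "(norm (f n - f k))\<^sup>2 \<le> (\<Sum>j=k..<n. ?g j)\<^sup>2" by (rule power_mono) simp
  also have "(\<Sum>j=k..<n. ?g j) = (\<Sum>j=k..<n. sqrt (1 / 2 ^ j) * (sqrt (2 ^ j) * ?g j))"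
    by (rule sum.cong) (auto simp: real_sqrt_divide)
  also have "\<dots>\<^sup>2 \<le> (\<Sum>j=k..<n. (sqrt (1 / 2 ^ j))\<^sup>2) * (\<Sum>j=k..<n. (sqrt (2 ^ j) * ?g j)\<^sup>2)"
    by (rule Cauchy_Schwarz_ineq_sum)
  also have "\<dots> = (\<Sum>j=k..<n. 1 / 2 ^ j) * (\<Sum>j=k..<n. 2 ^ j * (?g j)\<^sup>2)"
    by (simp add: power_mult_distrib)
  also have "\<dots> \<le> 2 / 2 ^ k * (\<Sum>j. 2 ^ j * (?g j)\<^sup>2)"
  proof (rule mult_mono)
    have "(\<Sum>j=k..<n. 1 / 2 ^ j) = 2 / 2 ^ k - 2 / (2 ^ n :: real)"
      using assms(2) by (induction n rule: dec_induct) simp_all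
    then show "(\<Sum>j=k..<n. 1 / 2 ^ j) \<le> 2 / (2 ^ k :: real)" by simp
    show "(\<Sum>j=k..<n. 2 ^ j * (?g j)\<^sup>2) \<le> (\<Sum>j. 2 ^ j * (?g j)\<^sup>2)"
      by (rule sum_le_suminf[OF assms(1)]) auto
  qed (auto intro: sum_nonneg)
  finally show ?thesis .
qed

text \<open>The weighted sum \<open>h\<close> of squared increments is integrable, hence finite almost everywhere; there the
  sequence is Cauchy, its squared distance to the limit is at most \<open>2 h / 2\<^sup>k\<close>, and integrating this
  bound gives the convergence in \<open>L\<^sup>2\<close>.\<close>

lemma L2_torus_complete:
  fixes f :: "nat \<Rightarrow> real^'n \<Rightarrow> 'b::euclidean_space"
  assumes f: "\<And>k. f k \<in> L2_torus"
    and d: "\<And>k. (\<integral>x. (norm (f (Suc k) x - f k x))\<^sup>2 \<partial>torus) \<le> C / 4 ^ k"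
  obtains v where "v \<in> L2_torus" "(\<lambda>k. \<integral>x. (norm (f k x - v x))\<^sup>2 \<partial>torus) \<longlonglongrightarrow> 0"
proof -
  define a where "a j x = 2 ^ j * (norm (f (Suc j) x - f j x))\<^sup>2" for j x
  define h where "h x = (\<Sum>j. a j x)" for x
  have fm: "f k \<in> borel_measurable lebesgue" for k using f by (simp add: L2_torus_def)
  have ia: "integrable torus (a j)" for j
    using L2_torus_diff[OF f f, of "Suc j" j] by (simp add: a_def[abs_def] L2_torus_def)
  have a0: "a j x \<ge> 0" for j x by (simp add: a_def)
  have Ia: "(\<integral>x. a j x \<partial>torus) \<le> C * (1/2) ^ j" for j
  proof -
    have "(\<integral>x. a j x \<partial>torus) \<le> 2 ^ j * (C / 4 ^ j)"
      unfolding a_def using mult_left_mono[OF d[of j], of "2 ^ j"] by simp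
    also have "\<dots> = C * (1/2) ^ j"
      by (simp add: power_divide field_simps flip: power_mult_distrib)
    finally show ?thesis .
  qed
  have sI: "summable (\<lambda>j. \<integral>x. a j x \<partial>torus)"
  proof (rule summable_comparison_test'[where N=0])
    show "summable (\<lambda>j. C * (1/2) ^ j)" by (intro summable_mult summable_geometric) simp
    show "norm (\<integral>x. a j x \<partial>torus) \<le> C * (1/2) ^ j" if "j \<ge> 0" for j
      using Ia[of j] a0 by simp
  qed
  have AEs: "AE x in torus. summable (\<lambda>j. a j x)"
  proof -
    have "(\<integral>\<^sup>+x. (\<Sum>j. ennreal (a j x)) \<partial>torus) = (\<Sum>j. \<integral>\<^sup>+x. ennreal (a j x) \<partial>torus)"
      by (rule nn_integral_suminf) (use ia in auto)
    also have "\<dots> = (\<Sum>j. ennreal (\<integral>x. a j x \<partial>torus))"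
      using ia a0 by (simp add: nn_integral_eq_integral)
    also have "\<dots> = ennreal (\<Sum>j. \<integral>x. a j x \<partial>torus)"
      by (rule suminf_ennreal2[OF _ sI]) (use a0 in auto)
    finally have "(\<integral>\<^sup>+x. (\<Sum>j. ennreal (a j x)) \<partial>torus) \<noteq> \<infinity>" by simp
    then have "AE x in torus. (\<Sum>j. ennreal (a j x)) \<noteq> \<infinity>"
      by (rule nn_integral_PInf_AE[rotated]) (use ia in auto)
    then show ?thesis
      by eventually_elim (use a0 in \<open>auto intro: summable_suminf_not_top\<close>)
  qed
  have ih: "integrable torus h"
    unfolding h_def
    by (rule integrable_suminf[OF ia]) (use AEs sI a0 in auto)
  \<comment> \<open>Being a function of the sequence of values at the point alone, the limit is periodic even where the sequence diverges.\<close>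
  define v where "v x = lim (\<lambda>k. f k x)" for x
  have vm: "v \<in> borel_measurable lebesgue"
    unfolding v_def by (rule borel_measurable_lim_metric[OF fm])
  have bound: "AE x in torus. \<forall>k. (norm (f k x - v x))\<^sup>2 \<le> 2 / 2 ^ k * h x"
    using AEs
  proof eventually_elim
    case (elim x)
    then have le: "(norm (f n x - f k x))\<^sup>2 \<le> 2 / 2 ^ k * h x" if "k \<le> n" for k n
      using norm_diff_square_le_weighted_sum[of "\<lambda>k. f k x", OF _ that] by (simp add: a_def h_def)
    have "Cauchy (\<lambda>k. f k x)"
      unfolding Cauchy_altdef2
    proof (intro allI impI)
      fix e :: real assume e: "e > 0"
      have "(\<lambda>k. 2 * h x * (1/2) ^ k) \<longlonglongrightarrow> 2 * h x * 0"
        by (intro tendsto_mult_left LIMSEQ_realpow_zero) auto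
      then have "\<forall>\<^sub>F k in sequentially. 2 * h x * (1/2) ^ k < e\<^sup>2"
        by (rule order_tendstoD) (use e in simp)
      then obtain k where k: "2 * h x * (1/2) ^ k < e\<^sup>2"
        using eventually_happens'[OF sequentially_bot] by blast
      have "dist (f n x) (f k x) < e" if "n \<ge> k" for n
      proof -
        have "(norm (f n x - f k x))\<^sup>2 < e\<^sup>2"
          using le[OF that] k by (simp add: power_divide)
        then show ?thesis using e by (simp add: dist_norm power_less_imp_less_base)
      qed
      then show "\<exists>N. \<forall>n\<ge>N. dist (f n x) (f N x) < e" by blast
    qed
    then have lim: "(\<lambda>n. f n x) \<longlonglongrightarrow> v x"
      unfolding v_def using Cauchy_convergent convergent_LIMSEQ_iff by blast
    show ?case
    proof
      fix k
      have "(\<lambda>n. (norm (f n x - f k x))\<^sup>2) \<longlonglongrightarrow> (norm (v x - f k x))\<^sup>2"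
        by (intro tendsto_intros lim)
      then have "(norm (v x - f k x))\<^sup>2 \<le> 2 / 2 ^ k * h x"
        by (rule LIMSEQ_le_const2) (use le in blast)
      then show "(norm (f k x - v x))\<^sup>2 \<le> 2 / 2 ^ k * h x" by (simp add: norm_minus_commute)
    qed
  qed
  have md: "(\<lambda>x. (norm (f k x - v x))\<^sup>2) \<in> borel_measurable torus" for k
    using measurable_torusI[OF fm] measurable_torusI[OF vm] by auto
  have h0: "AE x in torus. 0 \<le> h x"
    using AEs by eventually_elim (auto simp: h_def intro: suminf_nonneg a0)
  have id: "integrable torus (\<lambda>x. (norm (f k x - v x))\<^sup>2)" for k
  proof (rule Bochner_Integration.integrable_bound[OF _ md])
    show "integrable torus (\<lambda>x. 2 / 2 ^ k * h x)" using ih by simp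
    show "AE x in torus. norm ((norm (f k x - v x))\<^sup>2) \<le> norm (2 / 2 ^ k * h x)"
      using bound h0 by eventually_elim auto
  qed
  have Id: "(\<integral>x. (norm (f k x - v x))\<^sup>2 \<partial>torus) \<le> 2 * (\<integral>x. h x \<partial>torus) * (1/2) ^ k" for k
  proof -
    have "(\<integral>x. (norm (f k x - v x))\<^sup>2 \<partial>torus) \<le> (\<integral>x. 2 / 2 ^ k * h x \<partial>torus)"
      by (rule integral_mono_AE[OF id]) (use ih bound in auto)
    then show ?thesis by (simp add: power_divide)
  qed
  have pv: "periodic v"
    using f unfolding v_def by (auto simp: L2_torus_def periodic_def)
  have "v \<in> L2_torus"
  proof -
    have "(\<lambda>x. f 0 x - (f 0 x - v x)) \<in> L2_torus"
    proof (rule L2_torus_diff[OF f])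
      show "(\<lambda>x. f 0 x - v x) \<in> L2_torus"
        using f[of 0] pv vm fm[of 0] id[of 0] by (auto simp: L2_torus_def periodic_def)
    qed
    then show ?thesis by simp
  qed
  moreover have "(\<lambda>k. \<integral>x. (norm (f k x - v x))\<^sup>2 \<partial>torus) \<longlonglongrightarrow> 0"
  proof (rule Lim_null_comparison)
    have "(\<lambda>k. 2 * (\<integral>x. h x \<partial>torus) * (1/2) ^ k) \<longlonglongrightarrow> 2 * (\<integral>x. h x \<partial>torus) * 0"
      by (intro tendsto_mult_left LIMSEQ_realpow_zero) auto
    then show "(\<lambda>k. 2 * (\<integral>x. h x \<partial>torus) * (1/2) ^ k) \<longlonglongrightarrow> 0" by simp
  qed (use Id in auto)
  ultimately show ?thesis using that by blast
qed

text \<open>The Poincare inequality transfers the decay from the gradients to the functions, so both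
  sequences converge in \<open>L\<^sup>2\<close>, and the relation of being a weak gradient passes to the limit.\<close>

lemma H1_per_complete:
  fixes u :: "nat \<Rightarrow> real^'n \<Rightarrow> real"
  assumes u: "\<And>k. u k \<in> H1_per"
    and d: "\<And>k. (\<integral>x. (norm (wgrad (u (Suc k)) x - wgrad (u k) x))\<^sup>2 \<partial>torus) \<le> C / 4 ^ k"
  shows "\<exists>v\<in>H1_per. (\<lambda>k. H1_norm (\<lambda>x. u k x - v x)) \<longlonglongrightarrow> 0"
proof -
  have d': "(\<integral>x. (norm (u (Suc k) x - u k x))\<^sup>2 \<partial>torus) \<le> C / 4 ^ k" for k
  proof -
    let ?w = "\<lambda>x. u (Suc k) x - u k x" and ?G = "\<lambda>x. wgrad (u (Suc k)) x - wgrad (u k) x"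
    note D = H1_perD[OF u]
    have "(2 * pi)\<^sup>2 * (\<integral>x. (?w x)\<^sup>2 \<partial>torus) \<le> (\<integral>x. (norm (?G x))\<^sup>2 \<partial>torus)"
      by (rule Poincare)
        (use H1_perD(5)[OF H1_per_diff(1)[OF u u]] D in \<open>auto intro: L2_torus_diff has_weak_gradient_diff\<close>)
    moreover have "1 * (\<integral>x. (?w x)\<^sup>2 \<partial>torus) \<le> (2 * pi)\<^sup>2 * (\<integral>x. (?w x)\<^sup>2 \<partial>torus)"
      using pi_ge_two by (intro mult_right_mono one_le_power) auto
    ultimately show ?thesis using d[of k] by simp
  qed
  obtain v where v: "v \<in> L2_torus" "(\<lambda>k. \<integral>x. (norm (u k x - v x))\<^sup>2 \<partial>torus) \<longlonglongrightarrow> 0"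
    using L2_torus_complete[OF H1_perD(2)[OF u] d'] by blast
  obtain G where G: "G \<in> L2_torus" "(\<lambda>k. \<integral>x. (norm (wgrad (u k) x - G x))\<^sup>2 \<partial>torus) \<longlonglongrightarrow> 0"
    using L2_torus_complete[OF H1_perD(3)[OF u] d] by blast
  have v': "(\<lambda>k. \<integral>x. (u k x - v x)\<^sup>2 \<partial>torus) \<longlonglongrightarrow> 0" using v(2) by simp
  have vG: "has_weak_gradient v G"
    using has_weak_gradient_limit[OF H1_perD(2)[OF u] v(1) v' H1_perD(3)[OF u] G H1_perD(4)[OF u]] .
  have "(\<lambda>k. \<integral>x. u k x * 1 \<partial>torus) \<longlonglongrightarrow> (\<integral>x. v x * 1 \<partial>torus)"
    by (rule L2_tendsto_inner)
      (use v(1) v' H1_perD(2)[OF u] in \<open>auto intro: L2_torus_square_integrable continuous_square_integrable\<close>)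
  then have mean: "(\<integral>x. v x \<partial>torus) = 0"
    using H1_perD(5)[OF u] by (simp add: LIMSEQ_const_iff)
  note vH = H1_perI[OF v(1) G(1) vG mean]
  have "(\<integral>x. (norm (wgrad (\<lambda>x. u k x - v x) x))\<^sup>2 \<partial>torus) = (\<integral>x. (norm (wgrad (u k) x - G x))\<^sup>2 \<partial>torus)" for k
  proof (rule integral_cong_AE)
    have "wgrad (\<lambda>x. u k x - v x) \<in> borel_measurable torus" "wgrad (u k) \<in> borel_measurable torus" "G \<in> borel_measurable torus"
      using H1_perD(3)[OF H1_per_diff(1)[OF u vH(1)]] H1_perD(3)[OF u] G(1)
      by (auto simp: L2_torus_def intro: measurable_torusI)
    then show "(\<lambda>x. (norm (wgrad (\<lambda>x. u k x - v x) x))\<^sup>2) \<in> borel_measurable torus"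
       "(\<lambda>x. (norm (wgrad (u k) x - G x))\<^sup>2) \<in> borel_measurable torus" by auto
    show "AE x in torus. (norm (wgrad (\<lambda>x. u k x - v x) x))\<^sup>2 = (norm (wgrad (u k) x - G x))\<^sup>2"
      using H1_per_diff(2)[OF u[of k] vH(1)] vH(2) by eventually_elim simp
  qed
  then have "(\<lambda>k. H1_norm (\<lambda>x. u k x - v x)) \<longlonglongrightarrow> sqrt (0 + 0)"
    unfolding H1_norm_def using v' G(2) by (intro tendsto_real_sqrt tendsto_add) simp_all
  then show ?thesis using vH(1) by auto
qed

section \<open>The iteration\<close>

text \<open>One step of the iteration contracts differences of gradients by \<open>1 / (2 pi d)\<close>; the argument is the
  energy estimate described at the beginning.\<close>

lemma gradient_contraction:
  fixes V :: "real^'n \<Rightarrow> real^'n" and P :: "real^'n"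
  assumes s: "s > 0" and d: "d > 0"
    and V: "smooth V" "periodic V" "\<And>x. divergence V x = 0"
    and p: "p \<in> H1_per" and q: "q \<in> H1_per"
    and p': "weak_solution (d * s) V (\<lambda>x. c - s * norm (P + wgrad p x) - V x \<bullet> P) p'"
    and q': "weak_solution (d * s) V (\<lambda>x. c' - s * norm (P + wgrad q x) - V x \<bullet> P) q'"
  shows "(2 * pi * d)\<^sup>2 * (\<integral>x. (norm (wgrad p' x - wgrad q' x))\<^sup>2 \<partial>torus)
    \<le> (\<integral>x. (norm (wgrad p x - wgrad q x))\<^sup>2 \<partial>torus)"
proof -
  have H: "p' \<in> H1_per" "q' \<in> H1_per" using p' q' by (auto simp: weak_solution_def)
  define w where "w x = p' x - q' x" for x
  define D where "D x = wgrad p' x - wgrad q' x" for x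
  define E where "E x = wgrad p x - wgrad q x" for x
  have wH: "w \<in> H1_per" and wD: "AE x in torus. wgrad w x = D x"
    using H1_per_diff[OF H] by (simp_all add: w_def[abs_def] D_def)
  note wd = H1_perD[OF wH]
  have DL: "D \<in> L2_torus" and EL: "E \<in> L2_torus"
    unfolding D_def[abs_def] E_def[abs_def] by (intro L2_torus_diff H1_perD(3) H p q)+
  have wDw: "has_weak_gradient w D"
    unfolding w_def[abs_def] D_def[abs_def] using H1_perD[OF H(1)] H1_perD[OF H(2)]
    by (intro has_weak_gradient_diff)
  have sw: "square_integrable torus w" by (rule L2_torus_square_integrable[OF wd(2)])
  have cV: "continuous_on UNIV V" by (rule smooth_continuous_deriv(2)[OF V(1)])
  have measurable_L2: "g \<in> borel_measurable torus" if "g \<in> L2_torus" for g :: "real^'n \<Rightarrow> real^'n"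
    using that by (auto simp: L2_torus_def intro: measurable_torusI)
  define N where "N g x = norm (P + g x)" for g :: "real^'n \<Rightarrow> real^'n" and x
  have sN: "square_integrable torus (N g)" if g: "g \<in> L2_torus" for g
  proof -
    have "periodic (\<lambda>x::real^'n. - P)" by (simp add: periodic_def)
    then have "(\<lambda>x. - P) \<in> (L2_torus :: (real^'n \<Rightarrow> real^'n) set)"
      by (auto simp: L2_torus_def intro!: continuous_integrable_torus)
    from L2_torus_norm_square_integrable[OF L2_torus_diff[OF g this]]
    show ?thesis by (simp add: N_def[abs_def] add.commute)
  qed
  have iin: "integrable torus (\<lambda>x. g x \<bullet> g' x)" if g: "g \<in> L2_torus" "g' \<in> L2_torus" for g g' :: "real^'n \<Rightarrow> real^'n"
    unfolding inner_vec_def using g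
    by (auto intro!: Bochner_Integration.integrable_sum square_integrable_mult L2_torus_component)
  have iV: "integrable torus (\<lambda>x. (V x \<bullet> g x) * w x)" if g: "g \<in> L2_torus" for g
  proof -
    obtain B where B: "\<And>x. x \<in> cbox 0 1 \<Longrightarrow> norm (V x) \<le> B"
      using continuous_bounded_on_cube[OF cV] by blast
    have "square_integrable torus (\<lambda>x. V x $ i * g x $ i)" for i
    proof (rule square_integrable_bounded_mult[OF L2_torus_component[OF g]])
      show "(\<lambda>x. V x $ i) \<in> borel_measurable torus"
        by (rule continuous_measurable_torus) (intro continuous_intros cV)
      show "\<bar>V x $ i\<bar> \<le> B" if "x \<in> space torus" for x
        using B[of x] that component_le_norm_cart[of "V x" i] by simp
    qed
    then show ?thesis
      unfolding inner_vec_def by (auto intro!: square_integrable_mult sw square_integrable_sum)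
  qed
  have sVP: "square_integrable torus (\<lambda>x. V x \<bullet> P)"
    by (rule continuous_square_integrable) (intro continuous_intros cV)
  \<comment> \<open>The constant \<open>b\<close> drops out because the test function \<open>w\<close> has mean zero.\<close>
  have weq: "d * s * (\<integral>x. wgrad z x \<bullet> D x \<partial>torus) + (\<integral>x. (V x \<bullet> wgrad z x) * w x \<partial>torus)
       = - s * (\<integral>x. N g x * w x \<partial>torus) - (\<integral>x. (V x \<bullet> P) * w x \<partial>torus)"
    if z: "weak_solution (d * s) V (\<lambda>x. b - s * norm (P + g x) - V x \<bullet> P) z" and g: "g \<in> L2_torus" for z b g
  proof -
    have zH: "z \<in> H1_per" using z by (simp add: weak_solution_def)
    have "(\<integral>x. wgrad z x \<bullet> wgrad w x \<partial>torus) = (\<integral>x. wgrad z x \<bullet> D x \<partial>torus)"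
    proof (rule integral_cong_AE)
      show "AE x in torus. wgrad z x \<bullet> wgrad w x = wgrad z x \<bullet> D x"
        using wD by eventually_elim simp
    qed (use measurable_L2 H1_perD(3)[OF zH] wd(3) DL in auto)
    moreover have "(\<integral>x. (b - s * norm (P + g x) - V x \<bullet> P) * w x \<partial>torus)
       = - s * (\<integral>x. N g x * w x \<partial>torus) - (\<integral>x. (V x \<bullet> P) * w x \<partial>torus)"
    proof -
      have "(\<integral>x. (b - s * norm (P + g x) - V x \<bullet> P) * w x \<partial>torus)
          = (\<integral>x. b * w x - s * (N g x * w x) - (V x \<bullet> P) * w x \<partial>torus)"
        by (simp add: N_def algebra_simps)
      also have "\<dots> = b * (\<integral>x. w x \<partial>torus) - s * (\<integral>x. N g x * w x \<partial>torus) - (\<integral>x. (V x \<bullet> P) * w x \<partial>torus)"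
        by (simp add: square_integrable_integrable sw square_integrable_mult sN g sVP)
      finally show ?thesis using wd(5) by simp
    qed
    moreover have "d * s * (\<integral>x. wgrad z x \<bullet> wgrad w x \<partial>torus) + (\<integral>x. (V x \<bullet> wgrad z x) * w x \<partial>torus)
       = (\<integral>x. (b - s * norm (P + g x) - V x \<bullet> P) * w x \<partial>torus)"
      using z wd(1) unfolding weak_solution_def by blast
    ultimately show ?thesis by simp
  qed
  have X: "(\<integral>x. (norm (D x))\<^sup>2 \<partial>torus) = (\<integral>x. wgrad p' x \<bullet> D x \<partial>torus) - (\<integral>x. wgrad q' x \<bullet> D x \<partial>torus)"
    unfolding power2_norm_eq_inner
    by (subst (1) D_def) (simp add: inner_diff_left iin H1_perD(3) H DL)
  have "(\<integral>x. (V x \<bullet> wgrad p' x) * w x \<partial>torus) - (\<integral>x. (V x \<bullet> wgrad q' x) * w x \<partial>torus) = (\<integral>x. (V x \<bullet> D x) * w x \<partial>torus)"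
    unfolding D_def using iV[OF H1_perD(3)[OF H(1)]] iV[OF H1_perD(3)[OF H(2)]]
    by (simp add: inner_diff_right left_diff_distrib)
  also have "\<dots> = 0" by (rule transport_term_eq_0[OF V wd(2) DL wDw])
  finally have "d * s * (\<integral>x. (norm (D x))\<^sup>2 \<partial>torus)
      = s * ((\<integral>x. N (wgrad q) x * w x \<partial>torus) - (\<integral>x. N (wgrad p) x * w x \<partial>torus))"
    using weq[OF p' H1_perD(3)[OF p]] weq[OF q' H1_perD(3)[OF q]] unfolding X
    by (simp add: right_diff_distrib)
  then have "s * (d * (\<integral>x. (norm (D x))\<^sup>2 \<partial>torus))
      = s * ((\<integral>x. N (wgrad q) x * w x \<partial>torus) - (\<integral>x. N (wgrad p) x * w x \<partial>torus))"
    by (simp only: mult.left_commute mult.assoc)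
  then have "d * (\<integral>x. (norm (D x))\<^sup>2 \<partial>torus)
      = (\<integral>x. N (wgrad q) x * w x \<partial>torus) - (\<integral>x. N (wgrad p) x * w x \<partial>torus)"
    using s by simp
  also have "\<dots> = (\<integral>x. (N (wgrad q) x - N (wgrad p) x) * w x \<partial>torus)"
    by (simp add: left_diff_distrib square_integrable_mult sN sw H1_perD(3) p q)
  also have "\<dots> \<le> sqrt (\<integral>x. (N (wgrad q) x - N (wgrad p) x)\<^sup>2 \<partial>torus) * sqrt (\<integral>x. (w x)\<^sup>2 \<partial>torus)"
    using L2_Cauchy_Schwarz[OF square_integrable_diff[OF sN sN] sw, of "wgrad q" "wgrad p"] H1_perD(3) p q
    by (smt (verit))
  also have "\<dots> \<le> sqrt (\<integral>x. (norm (E x))\<^sup>2 \<partial>torus) * (sqrt (\<integral>x. (norm (D x))\<^sup>2 \<partial>torus) / (2 * pi))"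
  proof (rule mult_mono)
    have "(\<integral>x. (N (wgrad q) x - N (wgrad p) x)\<^sup>2 \<partial>torus) \<le> (\<integral>x. (norm (E x))\<^sup>2 \<partial>torus)"
    proof (rule integral_mono)
      show "integrable torus (\<lambda>x. (N (wgrad q) x - N (wgrad p) x)\<^sup>2)"
        using square_integrable_diff[OF sN[OF H1_perD(3)[OF q]] sN[OF H1_perD(3)[OF p]]]
        by (simp add: square_integrable_def)
      show "integrable torus (\<lambda>x. (norm (E x))\<^sup>2)" using EL by (simp add: L2_torus_def)
      fix x
      have "\<bar>N (wgrad q) x - N (wgrad p) x\<bar> \<le> norm ((P + wgrad q x) - (P + wgrad p x))"
        unfolding N_def by (rule norm_triangle_ineq3)
      also have "\<dots> = norm (E x)" by (simp add: E_def norm_minus_commute)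
      finally show "(N (wgrad q) x - N (wgrad p) x)\<^sup>2 \<le> (norm (E x))\<^sup>2"
        by (simp add: abs_le_square_iff[symmetric])
    qed
    then show "sqrt (\<integral>x. (N (wgrad q) x - N (wgrad p) x)\<^sup>2 \<partial>torus) \<le> sqrt (\<integral>x. (norm (E x))\<^sup>2 \<partial>torus)"
      by (rule real_sqrt_le_mono)
    have "sqrt ((2 * pi)\<^sup>2 * (\<integral>x. (w x)\<^sup>2 \<partial>torus)) \<le> sqrt (\<integral>x. (norm (D x))\<^sup>2 \<partial>torus)"
      by (rule real_sqrt_le_mono[OF Poincare[OF wd(2) DL wDw wd(5)]])
    then show "sqrt (\<integral>x. (w x)\<^sup>2 \<partial>torus) \<le> sqrt (\<integral>x. (norm (D x))\<^sup>2 \<partial>torus) / (2 * pi)"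
      by (simp add: real_sqrt_mult field_simps)
  qed auto
  finally have main: "d * (\<integral>x. (norm (D x))\<^sup>2 \<partial>torus)
     \<le> sqrt (\<integral>x. (norm (E x))\<^sup>2 \<partial>torus) * (sqrt (\<integral>x. (norm (D x))\<^sup>2 \<partial>torus) / (2 * pi))" .
  define y where "y = sqrt (\<integral>x. (norm (D x))\<^sup>2 \<partial>torus)"
  define e where "e = sqrt (\<integral>x. (norm (E x))\<^sup>2 \<partial>torus)"
  have y2: "(\<integral>x. (norm (D x))\<^sup>2 \<partial>torus) = y\<^sup>2" and e2: "(\<integral>x. (norm (E x))\<^sup>2 \<partial>torus) = e\<^sup>2"
    and y0: "y \<ge> 0" "e \<ge> 0"
    by (simp_all add: y_def e_def)
  have "(2 * pi * d * y) * y \<le> e * y"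
    using main y0 unfolding y2 e2 by (simp add: field_simps power2_eq_square)
  then have "2 * pi * d * y \<le> e"
    using y0 by (cases "y = 0") auto
  then have "(2 * pi * d * y)\<^sup>2 \<le> e\<^sup>2"
    by (rule power_mono) (use y0 d in auto)
  then show ?thesis
    using y2 e2 by (simp add: D_def E_def power_mult_distrib)
qed

theorem theoremB1:
  fixes P :: "real^'n" and s\<^sub>L d :: real
    and V :: "real^'n \<Rightarrow> real^'n"
    and u :: "nat \<Rightarrow> real^'n \<Rightarrow> real"
    and H :: "nat \<Rightarrow> real"
  assumes "s\<^sub>L > 0" and "d > 0"
    and "smooth V" and "periodic V"
    and "\<And>x. divergence V x = 0"
    and "(\<integral>x. V x \<partial>torus) = 0"
    and "u 1 \<in> H1_per"
    and "\<And>k. k \<ge> 1 \<Longrightarrow> H k = s\<^sub>L * (\<integral>x. norm (P + wgrad (u k) x) \<partial>torus)"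
    and "\<And>k. k \<ge> 1 \<Longrightarrow>
           weak_solution (d * s\<^sub>L) V
             (\<lambda>x. H k - s\<^sub>L * norm (P + wgrad (u k) x) - V x \<bullet> P) (u (Suc k))"
    and "d > sqrt (real CARD('n)) / pi"
  shows "\<exists>v\<in>H1_per. (\<lambda>k. H1_norm (\<lambda>x. u k x - v x)) \<longlonglongrightarrow> 0"
proof -
  have u: "u (Suc k) \<in> H1_per" for k
    using assms(7) assms(9)[of k] by (cases k) (auto simp: weak_solution_def)
  define X where "X k = (\<integral>x. (norm (wgrad (u (Suc (Suc k))) x - wgrad (u (Suc k)) x))\<^sup>2 \<partial>torus)" for k
  \<comment> \<open>For \<open>d > 1/pi\<close> the contraction factor \<open>1 / (2 pi d)\<close> is below \<open>1/2\<close>.\<close>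
  have "1 \<le> sqrt (real CARD('n))" by (simp add: Suc_leI)
  then have "1 / pi \<le> sqrt (real CARD('n)) / pi" by (simp add: divide_right_mono)
  then have "1 / pi < d" using assms(10) by linarith
  then have "2 < 2 * pi * d" by (simp add: field_simps)
  then have four: "4 \<le> (2 * pi * d)\<^sup>2" using power_mono[of 2 "2 * pi * d" 2] by simp
  have step: "X (Suc k) \<le> X k / 4" for k
  proof -
    have "(2 * pi * d)\<^sup>2 * X (Suc k) \<le> X k"
      unfolding X_def
      by (rule gradient_contraction[OF assms(1-5) u u assms(9) assms(9)]) auto
    moreover have "4 * X (Suc k) \<le> (2 * pi * d)\<^sup>2 * X (Suc k)"
      by (rule mult_right_mono[OF four]) (simp add: X_def)
    ultimately show ?thesis by simp
  qed
  have "X k \<le> X 0 / 4 ^ k" for k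
  proof (induction k)
    case (Suc k)
    have "X (Suc k) \<le> X k / 4" by (rule step)
    also have "\<dots> \<le> (X 0 / 4 ^ k) / 4" by (rule divide_right_mono[OF Suc]) simp
    finally show ?case by (simp add: mult.commute)
  qed simp
  then have "\<exists>v\<in>H1_per. (\<lambda>k. H1_norm (\<lambda>x. u (Suc k) x - v x)) \<longlonglongrightarrow> 0"
    unfolding X_def by (rule H1_per_complete[OF u])
  then obtain v where v: "v \<in> H1_per" "(\<lambda>k. H1_norm (\<lambda>x. u (Suc k) x - v x)) \<longlonglongrightarrow> 0" by blast
  from v(2) have "(\<lambda>k. H1_norm (\<lambda>x. u k x - v x)) \<longlonglongrightarrow> 0" by (rule LIMSEQ_imp_Suc)
  with v(1) show ?thesis by blast
qed

end
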